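(* Let $\equiv$ be a lattice congruence of the weak order on $\mathfrak{S}_n$ and let $\mathcal{I}=\mathcal{I}_\equiv$. For any $\sigma\in\mathfrak{S}_n$, the set $$\underline{\eta}_{\mathcal{I}}(\sigma)=\underline{\delta}\big(\pi_\downarrow^{\equiv}(\sigma)\big)=\{\underline{\alpha}(i,j,\sigma) : (i,j)\in B_{\mathcal{I}}(\sigma)\}$$ is the noncrossing arc diagram of $\mathcal{I}$ corresponding to the $\equiv$-congruence class of $\sigma$.
   Context: $[n]=\{1,\dots,n\}$, $]a,b[\,=\{a+1,\dots,b-1\}$, and $\mathfrak{S}_n$ is the set of permutations $\sigma=\sigma_1\dots\sigma_n$ of $[n]$. The weak order on $\mathfrak{S}_n$ is $\sigma\le\tau$ iff $\mathrm{inv}(\sigma)\subseteq\mathrm{inv}(\tau)$, where $\mathrm{inv}(\sigma)=\{(\sigma_i,\sigma_j) : i<j,\ \sigma_i>\sigma_j\}$; it is a lattice. An arc is a quadruple $(a,b,n,S)$ with $1\le a<b\le n$ and $S\subseteq\,]a,b[$; $\mathcal{A}_n$ is the set of arcs with third entry $n$. Two arcs $(a,b,n,R)$ and $(c,d,n,S)$ cross if there exist $r,s\in([a,b]\cap[c,d])\setminus(\{a,b\}\cap\{c,d\})$ with $r\in(R\cup\{a,b\})\setminus S$ and $s\in(S\cup\{c,d\})\setminus R$. A noncrossing arc diagram is a set of arcs of $\mathcal{A}_n$ such that any two distinct ones do not cross, have distinct left endpoints and have distinct right endpoints. A descent of $\sigma$ is an $i\in[n-1]$ with $\sigma_i>\sigma_{i+1}$.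 Let $B(\sigma)$ (denoted by a boxed backslash in the paper) be the set of pairs $(i,j)$ with $1\le i<j\le n$, $\sigma_i>\sigma_j$ and $\sigma(]i,j[)\cap\,]\sigma_j,\sigma_i[\,=\varnothing$. For $(i,j)\in B(\sigma)$ define the arc $\underline{\alpha}(i,j,\sigma)=(\sigma_j,\sigma_i,n,\{\sigma_k : k<i,\ \sigma_k\in\,]\sigma_j,\sigma_i[\,\})$. In particular this defines $\underline{\alpha}(i,i+1,\sigma)$ for each descent $i$ of $\sigma$; let $\underline{\delta}(\sigma)=\{\underline{\alpha}(i,i+1,\sigma) : i\text{ descent of }\sigma\}$. Order $B(\sigma)$ by $(i,j)\prec(k,\ell)$ if $i\le k<\ell\le j$ and $\sigma_k\ge\sigma_i>\sigma_j\ge\sigma_\ell$. For a set of arcs $\mathcal{I}$, let $B_{\mathcal{I}}(\sigma)$ be the set of $\prec$-maximal elements of $\{(i,j)\in B(\sigma) : \underline{\alpha}(i,j,\sigma)\in\mathcal{I}\}$. For a lattice congruence $\equiv$ of the weak order, each class is an interval; $\pi_\downarrow^{\equiv}(\sigma)$ is the minimal element of the class of $\sigma$, and $\mathcal{I}_\equiv$ is the set of arcs $\underline{\alpha}(i,i+1,\sigma)$ where $\sigma$ is a join-irreducible permutation (i.e. a permutation with exactly one descent $i$) with $\pi_\downarrow^{\equiv}(\sigma)=\sigma$. By a theorem of Reading, the map sending a $\equiv$-class with minimal permutation $\sigma$ to $\underline{\delta}(\sigma)$ is a bijection from $\equiv$-classes to the noncrossing arc diagrams contained in $\mathcal{I}_\equiv$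 (this is the correspondence meant in the claim). The map $\underline{\eta}_{\mathcal{I}}$ is defined by $\underline{\eta}_{\mathcal{I}}(\sigma)=\underline{\delta}(\pi_\downarrow^{\equiv}(\sigma))$. *)

theory Defs
  imports "HOL-Algebra.Lattice" "HOL-Combinatorics.Permutations"
begin

text \<open>
  A permutation of \<open>[n]\<close> is a function \<open>\<sigma> :: nat \<Rightarrow> nat\<close> with \<open>\<sigma> permutes {1..n}\<close>; the letter
  \<open>\<sigma>\<^sub>i\<close> of its one-line notation is \<open>\<sigma> i\<close>.
\<close>

definition inversions :: "nat \<Rightarrow> (nat \<Rightarrow> nat) \<Rightarrow> (nat \<times> nat) set" where
  "inversions n \<sigma> = {(\<sigma> i, \<sigma> j) | i j. i \<in> {1..n} \<and> j \<in> {1..n} \<and> i < j \<and> \<sigma> i > \<sigma> j}"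

definition weak_order :: "nat \<Rightarrow> (nat \<Rightarrow> nat) gorder" where
  "weak_order n =
     \<lparr>carrier = {\<sigma>. \<sigma> permutes {1..n}},
      eq = (=),
      le = (\<lambda>\<sigma> \<tau>. inversions n \<sigma> \<subseteq> inversions n \<tau>)\<rparr>"

definition lattice_congruence :: "('a, 'b) gorder_scheme \<Rightarrow> ('a \<times> 'a) set \<Rightarrow> bool" where
  "lattice_congruence L R \<longleftrightarrow>
     equiv (carrier L) R \<and>
     (\<forall>x x' y y'. (x, x') \<in> R \<longrightarrow> (y, y') \<in> R \<longrightarrow>
        (x \<squnion>\<^bsub>L\<^esub> y, x' \<squnion>\<^bsub>L\<^esub> y') \<in> R \<and> (x \<sqinter>\<^bsub>L\<^esub> y, x' \<sqinter>\<^bsub>L\<^esub> y') \<in> R)"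

type_synonym arc = "nat \<times> nat \<times> nat \<times> nat set"

definition arcs :: "nat \<Rightarrow> arc set" where
  "arcs n = {(a, b, n, S) | a b S. 1 \<le> a \<and> a < b \<and> b \<le> n \<and> S \<subseteq> {a<..<b}}"

text \<open>Only used on two arcs with the same third entry.\<close>

fun arcs_cross :: "arc \<Rightarrow> arc \<Rightarrow> bool" where
  "arcs_cross (a, b, _, R) (c, d, _, S) \<longleftrightarrow>
     (\<exists>r s. r \<in> ({a..b} \<inter> {c..d}) - ({a, b} \<inter> {c, d}) \<and>
            s \<in> ({a..b} \<inter> {c..d}) - ({a, b} \<inter> {c, d}) \<and>
            r \<in> (R \<union> {a, b}) - S \<and> s \<in> (S \<union> {c, d}) - R)"

definition noncrossing_arc_diagram :: "nat \<Rightarrow> arc set \<Rightarrow> bool" where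
  "noncrossing_arc_diagram n D \<longleftrightarrow>
     D \<subseteq> arcs n \<and>
     (\<forall>\<alpha>\<in>D. \<forall>\<beta>\<in>D. \<alpha> \<noteq> \<beta> \<longrightarrow>
        \<not> arcs_cross \<alpha> \<beta> \<and> fst \<alpha> \<noteq> fst \<beta> \<and> fst (snd \<alpha>) \<noteq> fst (snd \<beta>))"

definition descents :: "nat \<Rightarrow> (nat \<Rightarrow> nat) \<Rightarrow> nat set" where
  "descents n \<sigma> = {i. 1 \<le> i \<and> i < n \<and> \<sigma> i > \<sigma> (i + 1)}"

definition empty_boxes :: "nat \<Rightarrow> (nat \<Rightarrow> nat) \<Rightarrow> (nat \<times> nat) set" where
  "empty_boxes n \<sigma> =
     {(i, j). 1 \<le> i \<and> i < j \<and> j \<le> n \<and> \<sigma> i > \<sigma> j \<and> \<sigma> ` {i<..<j} \<inter> {\<sigma> j<..<\<sigma> i} = {}}"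

definition lower_arc :: "nat \<Rightarrow> (nat \<Rightarrow> nat) \<Rightarrow> nat \<times> nat \<Rightarrow> arc" where
  "lower_arc n \<sigma> = (\<lambda>(i, j). (\<sigma> j, \<sigma> i, n, {\<sigma> k | k. 1 \<le> k \<and> k < i \<and> \<sigma> k \<in> {\<sigma> j<..<\<sigma> i}}))"

definition lower_diagram :: "nat \<Rightarrow> (nat \<Rightarrow> nat) \<Rightarrow> arc set" where
  "lower_diagram n \<sigma> = {lower_arc n \<sigma> (i, i + 1) | i. i \<in> descents n \<sigma>}"

text \<open>The order \<open>\<prec>\<close> on \<^term>\<open>empty_boxes n \<sigma>\<close>; it is reflexive.\<close>

definition box_le :: "(nat \<Rightarrow> nat) \<Rightarrow> nat \<times> nat \<Rightarrow> nat \<times> nat \<Rightarrow> bool" where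
  "box_le \<sigma> = (\<lambda>(i, j) (k, l).
     i \<le> k \<and> k < l \<and> l \<le> j \<and> \<sigma> k \<ge> \<sigma> i \<and> \<sigma> i > \<sigma> j \<and> \<sigma> j \<ge> \<sigma> l)"

definition maximal_boxes :: "nat \<Rightarrow> arc set \<Rightarrow> (nat \<Rightarrow> nat) \<Rightarrow> (nat \<times> nat) set" where
  "maximal_boxes n \<I> \<sigma> =
     (let X = {p \<in> empty_boxes n \<sigma>. lower_arc n \<sigma> p \<in> \<I>}
      in {p \<in> X. \<forall>q\<in>X. box_le \<sigma> p q \<longrightarrow> q = p})"

text \<open>
  The classes of a lattice congruence of the weak order are intervals, so the minimal permutation
  of a class is its least element.
\<close>

definition class_min :: "nat \<Rightarrow> (nat \<Rightarrow> nat) set \<Rightarrow> (nat \<Rightarrow> nat)" where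
  "class_min n C = (THE \<tau>. least (weak_order n) \<tau> C)"

definition pi_down :: "nat \<Rightarrow> ((nat \<Rightarrow> nat) \<times> (nat \<Rightarrow> nat)) set \<Rightarrow> (nat \<Rightarrow> nat) \<Rightarrow> (nat \<Rightarrow> nat)" where
  "pi_down n R \<sigma> = class_min n (R `` {\<sigma>})"

definition congruence_arcs :: "nat \<Rightarrow> ((nat \<Rightarrow> nat) \<times> (nat \<Rightarrow> nat)) set \<Rightarrow> arc set" where
  "congruence_arcs n R =
     {lower_arc n \<sigma> (i, i + 1) | \<sigma> i.
        \<sigma> permutes {1..n} \<and> descents n \<sigma> = {i} \<and> pi_down n R \<sigma> = \<sigma>}"

text \<open>
  Reading's correspondence: this map is a bijection from the congruence classes onto the
  noncrossing arc diagrams contained in \<^term>\<open>congruence_arcs n R\<close>.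
\<close>

definition class_diagram :: "nat \<Rightarrow> (nat \<Rightarrow> nat) set \<Rightarrow> arc set" where
  "class_diagram n C = lower_diagram n (class_min n C)"

definition eta :: "nat \<Rightarrow> ((nat \<Rightarrow> nat) \<times> (nat \<Rightarrow> nat)) set \<Rightarrow> (nat \<Rightarrow> nat) \<Rightarrow> arc set" where
  "eta n R \<sigma> = lower_diagram n (pi_down n R \<sigma>)"

end

theory Submission
  imports Defs
begin

text \<open>
  Let \<open>\<pi> = \<pi>\<^sub>\<down>(\<sigma>)\<close>. The arcs of the \<open>\<prec>\<close>-maximal boxes with arc in \<open>\<I>\<close> form a set that is
  the same for all members of a congruence class, and for \<open>\<pi>\<close> this set is the diagram of descents.

  The descent from \<open>\<sigma>\<close> to \<open>\<pi>\<close> goes through covers \<open>\<rho> < \<tau>\<close> of the weak order that are contracted,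
  \<open>\<rho> \<equiv> \<tau>\<close>: since the weak order has meets, every class has a least element, and any other member
  has a lower cover in its class (\<open>exists_contracted_cover\<close>). Such a cover deletes a single inversion
  \<open>(b, a)\<close> and has an arc. Two covers with the same arc are perspective to the cover of one and the
  same join-irreducible permutation, so whether a cover is contracted depends on its arc only
  (\<open>same_arc_contracted_iff\<close>), and \<open>\<I>\<close> is the set of arcs that are not contracted
  (\<open>mem_congruence_arcs_iff\<close>). Hexagons in the weak order, spanned by three neighbouring values, show
  that a subarc of an arc in \<open>\<I>\<close> is again in \<open>\<I>\<close> (\<open>contracted_superarc\<close>).

  For a contracted cover the deleted box has its arc outside \<open>\<I>\<close>, and every box created by the
  deletion has this arc as a subarc, so it is outside \<open>\<I>\<close> too. All other boxes keep their
  arcs and their order, so the diagram of maximal boxes does not change (\<open>value_diagram_delete\<close>).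
  No lower cover of \<open>\<pi>\<close> is contracted, so all descents of \<open>\<pi>\<close> have arcs in \<open>\<I>\<close>, and since above
  every box there is a descent, the maximal boxes of \<open>\<pi>\<close> are its descents
  (\<open>maximal_boxes_eq_descents\<close>).
\<close>

section \<open>Permutations as biclosed sets of pairs\<close>

text \<open>
  Permutations are handled through their inversion sets, and these are exactly the biclosed sets:
  transitivity of \<open>N\<close> and of its complement say that "\<open>u\<close> stands left of \<open>v\<close>" is transitive.
  In this form a new permutation is obtained by writing down its inversions.
\<close>

definition biclosed :: "nat \<Rightarrow> (nat \<times> nat) set \<Rightarrow> bool" where
  "biclosed n N \<longleftrightarrow>
     N \<subseteq> {(b, a). 1 \<le> a \<and> a < b \<and> b \<le> n} \<and>
     (\<forall>c b a. (c, b) \<in> N \<longrightarrow> (b, a) \<in> N \<longrightarrow> (c, a) \<in> N) \<and>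
     (\<forall>c b a. (c, a) \<in> N \<longrightarrow> a < b \<longrightarrow> b < c \<longrightarrow> (c, b) \<in> N \<or> (b, a) \<in> N)"

lemma biclosedD:
  assumes "biclosed n N"
  shows biclosed_bounds: "(b, a) \<in> N \<Longrightarrow> 1 \<le> a \<and> a < b \<and> b \<le> n"
    and biclosed_trans: "(c, b) \<in> N \<Longrightarrow> (b, a) \<in> N \<Longrightarrow> (c, a) \<in> N"
    and biclosed_split: "(c, a) \<in> N \<Longrightarrow> a < b \<Longrightarrow> b < c \<Longrightarrow> (c, b) \<in> N \<or> (b, a) \<in> N"
  using assms unfolding biclosed_def by blast+

lemma permutes_interval_mem:
  assumes "\<sigma> permutes {1..n}" "1 \<le> i" "i \<le> n"
  shows "1 \<le> \<sigma> i" "\<sigma> i \<le> n"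
  using permutes_in_image[OF assms(1), of i] assms(2,3) by auto

lemma permutes_interval_index:
  assumes "\<sigma> permutes {1..n}" "1 \<le> v" "v \<le> n"
  obtains i where "1 \<le> i" "i \<le> n" "\<sigma> i = v"
proof -
  have "v \<in> \<sigma> ` {1..n}"
    using permutes_image[OF assms(1)] assms(2,3) by auto
  with that show ?thesis by auto
qed

lemma mem_inversions_iff:
  assumes "\<sigma> permutes {1..n}"
  shows "(\<sigma> i, \<sigma> j) \<in> inversions n \<sigma> \<longleftrightarrow> 1 \<le> i \<and> i < j \<and> j \<le> n \<and> \<sigma> j < \<sigma> i"
proof -
  have "inj \<sigma>" using assms by (rule permutes_inj)
  thus ?thesis unfolding inversions_def by (auto simp: inj_eq)
qed

lemma inversionsE:
  assumes "p \<in> inversions n \<sigma>"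
  obtains i j where "p = (\<sigma> i, \<sigma> j)" "1 \<le> i" "i < j" "j \<le> n" "\<sigma> j < \<sigma> i"
  using assms unfolding inversions_def by auto

lemma biclosed_inversions:
  assumes P: "\<sigma> permutes {1..n}"
  shows "biclosed n (inversions n \<sigma>)"
  unfolding biclosed_def
proof (intro conjI allI impI)
  show "inversions n \<sigma> \<subseteq> {(b, a). 1 \<le> a \<and> a < b \<and> b \<le> n}"
    using permutes_interval_mem[OF P] by (fastforce elim: inversionsE)
next
  fix c b a
  assume "(c, b) \<in> inversions n \<sigma>" "(b, a) \<in> inversions n \<sigma>"
  thus "(c, a) \<in> inversions n \<sigma>"
    by (elim inversionsE) (use mem_inversions_iff[OF P] permutes_inj[OF P] in \<open>auto simp: inj_eq\<close>)
next
  fix c b a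
  assume ca: "(c, a) \<in> inversions n \<sigma>" and ab: "a < b" and bc: "b < c"
  from ca obtain i j where ij: "c = \<sigma> i" "a = \<sigma> j" "1 \<le> i" "i < j" "j \<le> n"
    by (auto elim: inversionsE)
  have "1 \<le> b" "b \<le> n"
    using ab bc ij permutes_interval_mem[OF P, of i] by auto
  then obtain k where k: "1 \<le> k" "k \<le> n" "b = \<sigma> k"
    using permutes_interval_index[OF P] by metis
  have "i \<noteq> k" using bc ij k by auto
  then consider "i < k" | "k < i" by linarith
  thus "(c, b) \<in> inversions n \<sigma> \<or> (b, a) \<in> inversions n \<sigma>"
    using ij k ab bc by cases (auto simp: mem_inversions_iff[OF P])
qed

lemma finite_inversions: "finite (inversions n \<sigma>)"
proof -
  have "inversions n \<sigma> \<subseteq> (\<lambda>(i, j). (\<sigma> i, \<sigma> j)) ` ({1..n} \<times> {1..n})"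
    unfolding inversions_def by auto
  thus ?thesis by (rule finite_subset) auto
qed

text \<open>
  The relation "\<open>u\<close> stands left of \<open>v\<close>", read off from the inversion set. It determines the
  position of every value, hence the permutation.
\<close>

definition precedes :: "(nat \<times> nat) set \<Rightarrow> nat \<Rightarrow> nat \<Rightarrow> bool" where
  "precedes N u v \<longleftrightarrow> (if u < v then (v, u) \<notin> N else (u, v) \<in> N)"

lemma precedes_inversions_iff:
  assumes P: "\<sigma> permutes {1..n}" and "1 \<le> i" "i \<le> n" "1 \<le> j" "j \<le> n"
  shows "precedes (inversions n \<sigma>) (\<sigma> i) (\<sigma> j) \<longleftrightarrow> i < j"
proof (cases i j rule: linorder_cases)
  case equal thus ?thesis by (simp add: precedes_def mem_inversions_iff[OF P])
next
  case less
  hence "\<sigma> i \<noteq> \<sigma> j" using permutes_inj[OF P] by (auto simp: inj_eq)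
  thus ?thesis using less assms by (auto simp: precedes_def mem_inversions_iff[OF P])
next
  case greater
  hence "\<sigma> i \<noteq> \<sigma> j" using permutes_inj[OF P] by (auto simp: inj_eq)
  thus ?thesis using greater assms by (auto simp: precedes_def mem_inversions_iff[OF P])
qed

lemma index_eq_card_precedes:
  assumes P: "\<sigma> permutes {1..n}" and i: "1 \<le> i" "i \<le> n"
  shows "card {u \<in> {1..n}. u = \<sigma> i \<or> precedes (inversions n \<sigma>) u (\<sigma> i)} = i"
proof -
  have "{u \<in> {1..n}. u = \<sigma> i \<or> precedes (inversions n \<sigma>) u (\<sigma> i)} = \<sigma> ` {1..i}"
  proof (intro Set.set_eqI iffI)
    fix u assume u: "u \<in> {u \<in> {1..n}. u = \<sigma> i \<or> precedes (inversions n \<sigma>) u (\<sigma> i)}"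
    then obtain k where k: "1 \<le> k" "k \<le> n" "\<sigma> k = u"
      using permutes_interval_index[OF P, of u] by auto
    have "k \<le> i"
      using u k i precedes_inversions_iff[OF P, of k i] permutes_inj[OF P] by (auto simp: inj_eq)
    thus "u \<in> \<sigma> ` {1..i}" using k by auto
  next
    fix u assume "u \<in> \<sigma> ` {1..i}"
    then obtain k where k: "1 \<le> k" "k \<le> i" "u = \<sigma> k" by auto
    thus "u \<in> {u \<in> {1..n}. u = \<sigma> i \<or> precedes (inversions n \<sigma>) u (\<sigma> i)}"
      using i permutes_interval_mem[OF P, of k] precedes_inversions_iff[OF P, of k i]
      by (cases "k = i") auto
  qed
  moreover have "inj_on \<sigma> {1..i}" using permutes_inj[OF P] by (rule inj_on_subset) simp
  ultimately show ?thesis by (simp add: card_image)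
qed

lemma inversions_inject:
  assumes P: "\<sigma> permutes {1..n}" and Q: "\<tau> permutes {1..n}"
    and eq: "inversions n \<sigma> = inversions n \<tau>"
  shows "\<sigma> = \<tau>"
proof
  fix i
  show "\<sigma> i = \<tau> i"
  proof (cases "1 \<le> i \<and> i \<le> n")
    case True
    hence "1 \<le> \<sigma> i" "\<sigma> i \<le> n" using permutes_interval_mem[OF P] by auto
    then obtain k where k: "1 \<le> k" "k \<le> n" "\<tau> k = \<sigma> i"
      using permutes_interval_index[OF Q] by metis
    have "k = i"
      using index_eq_card_precedes[OF Q k(1,2)] index_eq_card_precedes[OF P, of i] True k(3) eq
      by simp
    thus ?thesis using k by simp
  next
    case False
    thus ?thesis using P Q by (auto simp: permutes_def)
  qed
qed

lemma precedes_trans: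
  assumes N: "biclosed n N" and "precedes N u v" "precedes N v w"
  shows "precedes N u w"
proof (cases u w rule: linorder_cases)
  case less
  have "(w, u) \<notin> N"
  proof
    assume wu: "(w, u) \<in> N"
    consider "v < u" | "u < v" "v < w" | "w < v"
      using assms(2,3) biclosed_bounds[OF N] by (force simp: precedes_def split: if_splits)
    thus False
      by cases (use wu less assms(2,3) biclosed_trans[OF N] biclosed_split[OF N wu] in
        \<open>auto simp: precedes_def split: if_splits\<close>)
  qed
  with less show ?thesis by (simp add: precedes_def)
next
  case equal
  thus ?thesis using assms(2,3) biclosed_bounds[OF N] by (fastforce simp: precedes_def split: if_splits)
next
  case greater
  consider "v < w" "(u, v) \<in> N" "(w, v) \<notin> N" | "(u, v) \<in> N" "(v, w) \<in> N"
    | "u < v" "(v, u) \<notin> N" "(v, w) \<in> N"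
    using assms(2,3) greater biclosed_bounds[OF N] by (force simp: precedes_def split: if_splits)
  hence "(u, w) \<in> N"
    by cases (use greater biclosed_trans[OF N] biclosed_split[OF N] in blast)+
  with greater show ?thesis by (simp add: precedes_def)
qed

lemma precedes_total: "u \<noteq> v \<Longrightarrow> precedes N u v \<or> precedes N v u"
  by (auto simp: precedes_def)

lemma precedes_asym:
  assumes N: "biclosed n N" shows "precedes N u v \<Longrightarrow> \<not> precedes N v u"
  using biclosed_bounds[OF N] by (fastforce simp: precedes_def split: if_splits)

text \<open>
  For biclosed \<open>N\<close> the relation \<^const>\<open>precedes\<close> is a strict linear order, and listing the values
  in this order gives the permutation: the position of a value is its rank.
\<close>

lemma exists_permutation_of_biclosed:
  assumes N: "biclosed n N"
  obtains \<sigma> where "\<sigma> permutes {1..n}" "inversions n \<sigma> = N"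
proof -
  define rank where "rank v = card {u \<in> {1..n}. u = v \<or> precedes N u v}" for v
  define p where "p v = (if v \<in> {1..n} then rank v else v)" for v
  have less: "rank u < rank v" if "precedes N u v" "u \<in> {1..n}" "v \<in> {1..n}" for u v
    unfolding rank_def
  proof (rule psubset_card_mono)
    have "u \<noteq> v" using that(1) precedes_asym[OF N] by blast
    moreover have "v \<notin> {w \<in> {1..n}. w = u \<or> precedes N w u}"
      using calculation precedes_asym[OF N that(1)] by auto
    ultimately show "{w \<in> {1..n}. w = u \<or> precedes N w u} \<subset> {w \<in> {1..n}. w = v \<or> precedes N w v}"
      using that precedes_trans[OF N] by blast
  qed simp
  have less_iff: "p u < p v \<longleftrightarrow> precedes N u v" if "u \<in> {1..n}" "v \<in> {1..n}" for u v
  proof (cases "u = v")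
    case True thus ?thesis using precedes_asym[OF N] by auto
  next
    case False
    thus ?thesis using less[of u v] less[of v u] that precedes_total[of u v N]
      precedes_asym[OF N, of u v] by (auto simp: p_def)
  qed
  have inj: "inj_on p {1..n}"
    using less_iff precedes_total by (intro inj_onI) (metis less_irrefl)
  have "p ` {1..n} \<subseteq> {1..n}"
  proof
    fix y assume "y \<in> p ` {1..n}"
    then obtain v where v: "v \<in> {1..n}" "y = rank v" by (auto simp: p_def)
    have "rank v \<le> card {1..n}" unfolding rank_def by (rule card_mono) auto
    moreover have "rank v > 0" unfolding rank_def using v by (subst card_gt_0_iff) auto
    ultimately show "y \<in> {1..n}" using v by auto
  qed
  with inj have "bij_betw p {1..n} {1..n}"
    by (simp add: bij_betw_def endo_inj_surj)
  hence P: "p permutes {1..n}"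
    by (rule bij_imp_permutes) (auto simp: p_def)
  let ?s = "inv p"
  have Q: "?s permutes {1..n}" using P by (rule permutes_inv)
  have ps: "p (?s i) = i" for i using permutes_inverses(1)[OF P] .
  have sp: "?s (p i) = i" for i using permutes_inverses(2)[OF P] .
  have "inversions n ?s = N"
  proof (rule Set.set_eqI)
    fix x show "x \<in> inversions n ?s \<longleftrightarrow> x \<in> N"
    proof
      assume "x \<in> inversions n ?s"
      then obtain i j where x: "x = (?s i, ?s j)" "1 \<le> i" "i < j" "j \<le> n" "?s j < ?s i"
        by (rule inversionsE)
      hence "precedes N (?s i) (?s j)"
        using less_iff[of "?s i" "?s j"] permutes_interval_mem[OF Q, of i]
          permutes_interval_mem[OF Q, of j] by (auto simp: ps)
      thus "x \<in> N" using x by (auto simp: precedes_def split: if_splits)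
    next
      assume x: "x \<in> N"
      obtain b a where ba: "x = (b, a)" by (cases x)
      with x have B: "1 \<le> a" "a < b" "b \<le> n" using biclosed_bounds[OF N] by auto
      have "p b < p a" using less_iff[of b a] B x ba by (auto simp: precedes_def)
      thus "x \<in> inversions n ?s"
        using mem_inversions_iff[OF Q, of "p b" "p a"] B ba permutes_interval_mem[OF P, of a]
           permutes_interval_mem[OF P, of b]
        by (simp add: sp)
    qed
  qed
  with Q that show ?thesis by blast
qed

section \<open>Meets in the weak order\<close>

text \<open>
  Meets and joins are phrased through inversion sets. Apart from the existence of meets, every meet
  and join below is one whose value is known beforehand, so that a short verification of the bounds
  suffices.
\<close>

definition is_meet :: "nat \<Rightarrow> (nat \<Rightarrow> nat) \<Rightarrow> (nat \<Rightarrow> nat) \<Rightarrow> (nat \<Rightarrow> nat) \<Rightarrow> bool" where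
  "is_meet n \<sigma> \<tau> \<mu> \<longleftrightarrow>
     \<mu> permutes {1..n} \<and> inversions n \<mu> \<subseteq> inversions n \<sigma> \<inter> inversions n \<tau> \<and>
     (\<forall>\<rho>. \<rho> permutes {1..n} \<longrightarrow> inversions n \<rho> \<subseteq> inversions n \<sigma> \<inter> inversions n \<tau> \<longrightarrow>
        inversions n \<rho> \<subseteq> inversions n \<mu>)"

definition is_join :: "nat \<Rightarrow> (nat \<Rightarrow> nat) \<Rightarrow> (nat \<Rightarrow> nat) \<Rightarrow> (nat \<Rightarrow> nat) \<Rightarrow> bool" where
  "is_join n \<sigma> \<tau> \<mu> \<longleftrightarrow>
     \<mu> permutes {1..n} \<and> inversions n \<sigma> \<union> inversions n \<tau> \<subseteq> inversions n \<mu> \<and>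
     (\<forall>\<rho>. \<rho> permutes {1..n} \<longrightarrow> inversions n \<sigma> \<union> inversions n \<tau> \<subseteq> inversions n \<rho> \<longrightarrow>
        inversions n \<mu> \<subseteq> inversions n \<rho>)"

lemma biclosed_complement:
  assumes N: "biclosed n N"
  shows "biclosed n ({(b, a). 1 \<le> a \<and> a < b \<and> b \<le> n} - N)"
  unfolding biclosed_def
proof (intro conjI allI impI)
  fix c b a
  assume "(c, a) \<in> {(b, a). 1 \<le> a \<and> a < b \<and> b \<le> n} - N" "a < b" "b < c"
  thus "(c, b) \<in> {(b, a). 1 \<le> a \<and> a < b \<and> b \<le> n} - N \<or>
      (b, a) \<in> {(b, a). 1 \<le> a \<and> a < b \<and> b \<le> n} - N"
    using biclosed_trans[OF N, of c b a] by auto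
qed (use biclosed_split[OF N] in auto)

text \<open>
  A chain from \<open>c\<close> to \<open>a\<close> in the union descends from above \<open>b\<close> to below \<open>b\<close> in some single step,
  which lies in \<open>M\<close> or in \<open>N\<close> and can be split at \<open>b\<close> there. Hence the transitive closure keeps
  the splitting property.
\<close>

lemma biclosed_trancl_Un:
  assumes M: "biclosed n M" and N: "biclosed n N"
  shows "biclosed n ((M \<union> N)\<^sup>+)"
proof -
  have edge: "1 \<le> a \<and> a < b \<and> b \<le> n" if "(b, a) \<in> M \<union> N" for b a
    using that biclosed_bounds[OF M] biclosed_bounds[OF N] by blast
  have edge_split: "(c, b) \<in> M \<union> N \<or> (b, a) \<in> M \<union> N"
    if "(c, a) \<in> M \<union> N" "a < b" "b < c" for c b a
    using that biclosed_split[OF M] biclosed_split[OF N] by blast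
  have bounds: "1 \<le> a \<and> a < b \<and> b \<le> n" if "(b, a) \<in> (M \<union> N)\<^sup>+" for b a
    using that
  proof (induction)
    case (base y) thus ?case by (rule edge)
  next
    case (step y z) thus ?case using edge[of y z] by linarith
  qed
  have split: "(c, b) \<in> (M \<union> N)\<^sup>+ \<or> (b, a) \<in> (M \<union> N)\<^sup>+"
    if "(c, a) \<in> (M \<union> N)\<^sup>+" "a < b" "b < c" for c b a
    using that
  proof (induction)
    case (base y)
    thus ?case using edge_split[of c y b] by (auto intro: r_into_trancl)
  next
    case (step y z)
    consider "y < b" | "y = b" | "b < y" by linarith
    thus ?case
    proof cases
      case 1
      hence "(c, b) \<in> (M \<union> N)\<^sup>+ \<or> (b, y) \<in> (M \<union> N)\<^sup>+" using step by blast
      thus ?thesis using trancl_into_trancl[OF _ step.hyps(2), of b] by argo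
    next
      case 2
      thus ?thesis using step.hyps(1) by simp
    next
      case 3
      hence "(y, b) \<in> M \<union> N \<or> (b, z) \<in> M \<union> N"
        using edge_split step by blast
      thus ?thesis
        using trancl_into_trancl[OF step.hyps(1), of b] r_into_trancl[where r = "M \<union> N"]
        by blast
    qed
  qed
  show ?thesis unfolding biclosed_def
  proof (intro conjI allI impI)
    show "(M \<union> N)\<^sup>+ \<subseteq> {(b, a). 1 \<le> a \<and> a < b \<and> b \<le> n}"
      using bounds by (intro subrelI) blast
    show "(c, a) \<in> (M \<union> N)\<^sup>+" if "(c, b) \<in> (M \<union> N)\<^sup>+" "(b, a) \<in> (M \<union> N)\<^sup>+" for c b a
      using that by (rule trancl_trans)
  qed (rule split)
qed

text \<open>
  The noninversions of a common lower bound form a transitive set containing the noninversions of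
  both permutations. The transitive closure of the latter is biclosed, so its complement is the
  inversion set of the greatest lower bound.
\<close>

lemma exists_meet:
  assumes P: "\<sigma> permutes {1..n}" and Q: "\<tau> permutes {1..n}"
  obtains \<mu> where "is_meet n \<sigma> \<tau> \<mu>"
proof -
  define U where "U = {(b, a). 1 \<le> a \<and> a < b \<and> b \<le> n}"
  define X where "X = ((U - inversions n \<sigma>) \<union> (U - inversions n \<tau>))\<^sup>+"
  have in_U: "inversions n \<rho> \<subseteq> U" if "\<rho> permutes {1..n}" for \<rho>
    using biclosed_inversions[OF that] unfolding biclosed_def U_def by blast
  have "biclosed n (U - X)"
    unfolding U_def X_def
    by (intro biclosed_complement biclosed_trancl_Un biclosed_inversions P Q)
  then obtain \<mu> where mu: "\<mu> permutes {1..n}" "inversions n \<mu> = U - X"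
    by (rule exists_permutation_of_biclosed)
  have "U - X \<subseteq> inversions n \<sigma> \<inter> inversions n \<tau>"
    unfolding X_def by auto
  moreover have "inversions n \<rho> \<subseteq> U - X"
    if R: "\<rho> permutes {1..n}" and sub: "inversions n \<rho> \<subseteq> inversions n \<sigma> \<inter> inversions n \<tau>" for \<rho>
  proof -
    have "biclosed n (U - inversions n \<rho>)"
      unfolding U_def by (intro biclosed_complement biclosed_inversions R)
    hence "trans (U - inversions n \<rho>)" by (intro transI) (rule biclosed_trans)
    hence "X \<subseteq> U - inversions n \<rho>"
      unfolding X_def using sub
      by (metis (no_types, lifting) Diff_mono Un_least le_inf_iff order_refl trancl_id trancl_mono_subset)
    thus ?thesis using in_U[OF R] by blast
  qed
  ultimately have "is_meet n \<sigma> \<tau> \<mu>" unfolding is_meet_def using mu by auto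
  thus ?thesis by (rule that)
qed

lemma is_meet_left: "\<sigma> permutes {1..n} \<Longrightarrow> inversions n \<sigma> \<subseteq> inversions n \<tau> \<Longrightarrow> is_meet n \<sigma> \<tau> \<sigma>"
  by (auto simp: is_meet_def)

lemma is_meet_right: "\<tau> permutes {1..n} \<Longrightarrow> inversions n \<tau> \<subseteq> inversions n \<sigma> \<Longrightarrow> is_meet n \<sigma> \<tau> \<tau>"
  by (auto simp: is_meet_def)

lemma is_join_right: "\<tau> permutes {1..n} \<Longrightarrow> inversions n \<sigma> \<subseteq> inversions n \<tau> \<Longrightarrow> is_join n \<sigma> \<tau> \<tau>"
  by (auto simp: is_join_def)

lemma meet_weak_order_eq:
  assumes P: "\<sigma> permutes {1..n}" and Q: "\<tau> permutes {1..n}" and M: "is_meet n \<sigma> \<tau> \<mu>"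
  shows "\<sigma> \<sqinter>\<^bsub>weak_order n\<^esub> \<tau> = \<mu>"
proof -
  have *: "greatest (weak_order n) \<rho> (Lower (weak_order n) {\<sigma>, \<tau>}) \<longleftrightarrow> is_meet n \<sigma> \<tau> \<rho>" for \<rho>
  proof -
    have "Lower (weak_order n) {\<sigma>, \<tau>} =
        {\<rho>. \<rho> permutes {1..n} \<and> inversions n \<rho> \<subseteq> inversions n \<sigma> \<inter> inversions n \<tau>}"
      unfolding Lower_def weak_order_def using P Q by fastforce
    thus ?thesis by (auto simp: greatest_def is_meet_def weak_order_def)
  qed
  have "\<rho> = \<mu>" if "is_meet n \<sigma> \<tau> \<rho>" for \<rho>
    using that M inversions_inject[of \<rho> n \<mu>] unfolding is_meet_def by blast
  thus ?thesis unfolding meet_def inf_def * using M by blast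
qed

lemma join_weak_order_eq:
  assumes P: "\<sigma> permutes {1..n}" and Q: "\<tau> permutes {1..n}" and M: "is_join n \<sigma> \<tau> \<mu>"
  shows "\<sigma> \<squnion>\<^bsub>weak_order n\<^esub> \<tau> = \<mu>"
proof -
  have *: "least (weak_order n) \<rho> (Upper (weak_order n) {\<sigma>, \<tau>}) \<longleftrightarrow> is_join n \<sigma> \<tau> \<rho>" for \<rho>
  proof -
    have "Upper (weak_order n) {\<sigma>, \<tau>} =
        {\<rho>. \<rho> permutes {1..n} \<and> inversions n \<sigma> \<union> inversions n \<tau> \<subseteq> inversions n \<rho>}"
      unfolding Upper_def weak_order_def using P Q by fastforce
    thus ?thesis by (auto simp: least_def is_join_def weak_order_def)
  qed
  have "\<rho> = \<mu>" if "is_join n \<sigma> \<tau> \<rho>" for \<rho>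
    using that M inversions_inject[of \<rho> n \<mu>] unfolding is_join_def by blast
  thus ?thesis unfolding join_def sup_def * using M by blast
qed

section \<open>Covers and their arcs\<close>

text \<open>
  The set of values strictly between \<open>a\<close> and \<open>b\<close> standing left of \<open>b\<close>, which is the fourth entry of
  \<^const>\<open>lower_arc\<close>.
\<close>

definition arc_interior :: "(nat \<times> nat) set \<Rightarrow> nat \<Rightarrow> nat \<Rightarrow> nat set" where
  "arc_interior N b a = {v. a < v \<and> v < b \<and> (b, v) \<notin> N}"

definition covers_via :: "nat \<Rightarrow> (nat \<Rightarrow> nat) \<Rightarrow> (nat \<Rightarrow> nat) \<Rightarrow> nat \<Rightarrow> nat \<Rightarrow> nat set \<Rightarrow> bool" where
  "covers_via n \<rho> \<tau> a b S \<longleftrightarrow>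
     \<rho> permutes {1..n} \<and> \<tau> permutes {1..n} \<and>
     (b, a) \<notin> inversions n \<rho> \<and> inversions n \<tau> = insert (b, a) (inversions n \<rho>) \<and>
     S = arc_interior (inversions n \<tau>) b a"

text \<open>
  The inversion set of the smallest permutation having the arc \<open>(a, b, n, S)\<close> at a descent: the
  values forced to stand left (\<open>b\<close> and \<open>S\<close>) against those forced to stand right. This permutation
  is the join-irreducible element attached to the arc, and deleting \<open>(b, a)\<close> gives its only lower
  cover.
\<close>

definition arc_inversions :: "nat \<Rightarrow> nat \<Rightarrow> nat set \<Rightarrow> (nat \<times> nat) set" where
  "arc_inversions a b S = {(s, t). t < s \<and> s \<in> insert b S \<and> t \<in> insert a ({a<..<b} - S)}"

lemma biclosed_arc_inversions:
  assumes "1 \<le> a" "a < b" "b \<le> n" "S \<subseteq> {a<..<b}"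
  shows "biclosed n (arc_inversions a b S)" "biclosed n (arc_inversions a b S - {(b, a)})"
proof -
  have S: "a < s \<and> s < b" if "s \<in> S" for s using that assms(4) by auto
  show "biclosed n (arc_inversions a b S)"
    unfolding biclosed_def arc_inversions_def using assms(1-3) S by (auto, force+)
  show "biclosed n (arc_inversions a b S - {(b, a)})"
    unfolding biclosed_def arc_inversions_def using assms(1-3) S by (auto, force+)
qed

lemma covers_via_valid:
  assumes "covers_via n \<rho> \<tau> a b S"
  shows "1 \<le> a" "a < b" "b \<le> n" "S \<subseteq> {a<..<b}"
proof -
  have "(b, a) \<in> inversions n \<tau>" "\<tau> permutes {1..n}" using assms by (auto simp: covers_via_def)
  thus "1 \<le> a" "a < b" "b \<le> n" using biclosed_bounds[OF biclosed_inversions] by blast+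
  show "S \<subseteq> {a<..<b}" using assms by (auto simp: covers_via_def arc_interior_def)
qed

text \<open>
  In a cover removing \<open>(b, a)\<close>, no value between \<open>a\<close> and \<open>b\<close> stands between them in position, so
  values of \<open>S\<close> stand left of \<open>b\<close> and the others stand right of \<open>a\<close>.
\<close>

lemma arc_inversions_subset:
  assumes C: "covers_via n \<rho> \<tau> a b S"
  shows "arc_inversions a b S \<subseteq> inversions n \<tau>"
proof -
  have B: "biclosed n (inversions n \<tau>)"
    using C by (intro biclosed_inversions) (simp add: covers_via_def)
  have ba: "(b, a) \<in> inversions n \<tau>" using C by (auto simp: covers_via_def)
  have S: "v \<in> S \<longleftrightarrow> (b, v) \<notin> inversions n \<tau>" if "a < v" "v < b" for v
    using C that by (auto simp: covers_via_def arc_interior_def)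
  have S_sub: "S \<subseteq> {a<..<b}" by (rule covers_via_valid[OF C])
  have S_a: "(v, a) \<in> inversions n \<tau>" if "v \<in> S" for v
    using S[of v] S_sub that biclosed_split[OF B ba, of v] by auto
  have "(s, t) \<in> inversions n \<tau>" if st: "(s, t) \<in> arc_inversions a b S" for s t
  proof (cases "s = b")
    case True
    thus ?thesis using st ba S[of t] by (auto simp: arc_inversions_def)
  next
    case False
    hence s: "s \<in> S" "t < s" using st by (auto simp: arc_inversions_def)
    show ?thesis
    proof (cases "t = a")
      case True thus ?thesis using S_a s by simp
    next
      case False
      hence t: "a < t" "t < b" "t \<notin> S" using st by (auto simp: arc_inversions_def)
      hence "(b, t) \<in> inversions n \<tau>" using S by blast
      moreover have "(b, s) \<notin> inversions n \<tau>" using S[of s] s S_sub by auto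
      ultimately show ?thesis using biclosed_split[OF B, of b t s] s S_sub by auto
    qed
  qed
  thus ?thesis by auto
qed

text \<open>
  Sort the values by a key, and increasingly among equal keys.
\<close>

lemma exists_permutation_of_key:
  fixes k :: "nat \<Rightarrow> nat"
  obtains \<sigma> where "\<sigma> permutes {1..n}"
    "inversions n \<sigma> = {(s, t). 1 \<le> t \<and> t < s \<and> s \<le> n \<and> k s < k t}"
proof (rule exists_permutation_of_biclosed)
  show "biclosed n {(s, t). 1 \<le> t \<and> t < s \<and> s \<le> n \<and> k s < k t}"
    unfolding biclosed_def by auto
qed

section \<open>Contracted covers\<close>

locale weak_order_congruence =
  fixes n :: nat and R :: "((nat \<Rightarrow> nat) \<times> (nat \<Rightarrow> nat)) set"
  assumes congruence: "lattice_congruence (weak_order n) R"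
begin

lemma equiv_R: "equiv {\<sigma>. \<sigma> permutes {1..n}} R"
  using congruence by (simp add: lattice_congruence_def weak_order_def)

lemma R_refl: "\<sigma> permutes {1..n} \<Longrightarrow> (\<sigma>, \<sigma>) \<in> R"
  using equiv_R by (auto simp: equiv_def refl_on_def)

lemma R_sym: "(\<sigma>, \<tau>) \<in> R \<Longrightarrow> (\<tau>, \<sigma>) \<in> R"
  using equiv_R by (auto simp: equiv_def sym_def)

lemma R_trans: "(\<sigma>, \<tau>) \<in> R \<Longrightarrow> (\<tau>, \<rho>) \<in> R \<Longrightarrow> (\<sigma>, \<rho>) \<in> R"
  using equiv_R by (meson equivE transE)

lemma R_permutes:
  assumes "(\<sigma>, \<tau>) \<in> R" shows "\<sigma> permutes {1..n}" "\<tau> permutes {1..n}"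
  using equiv_R assms by (auto simp: equiv_def refl_on_def)

lemma R_meet:
  assumes "(\<sigma>, \<sigma>') \<in> R" "\<tau> permutes {1..n}" "is_meet n \<sigma> \<tau> \<mu>" "is_meet n \<sigma>' \<tau> \<mu>'"
  shows "(\<mu>, \<mu>') \<in> R"
proof -
  have "(\<sigma> \<sqinter>\<^bsub>weak_order n\<^esub> \<tau>, \<sigma>' \<sqinter>\<^bsub>weak_order n\<^esub> \<tau>) \<in> R"
    using congruence assms(1) R_refl[OF assms(2)] unfolding lattice_congruence_def by blast
  thus ?thesis using meet_weak_order_eq R_permutes[OF assms(1)] assms(2-) by metis
qed

lemma R_join:
  assumes "(\<sigma>, \<sigma>') \<in> R" "\<tau> permutes {1..n}" "is_join n \<sigma> \<tau> \<mu>" "is_join n \<sigma>' \<tau> \<mu>'"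
  shows "(\<mu>, \<mu>') \<in> R"
proof -
  have "(\<sigma> \<squnion>\<^bsub>weak_order n\<^esub> \<tau>, \<sigma>' \<squnion>\<^bsub>weak_order n\<^esub> \<tau>) \<in> R"
    using congruence assms(1) R_refl[OF assms(2)] unfolding lattice_congruence_def by blast
  thus ?thesis using join_weak_order_eq R_permutes[OF assms(1)] assms(2-) by metis
qed

lemma R_between:
  assumes "(\<sigma>, \<tau>) \<in> R" "\<rho> permutes {1..n}"
    "inversions n \<sigma> \<subseteq> inversions n \<rho>" "inversions n \<rho> \<subseteq> inversions n \<tau>"
  shows "(\<sigma>, \<rho>) \<in> R"
  using R_meet[OF assms(1,2) is_meet_left is_meet_right] R_permutes[OF assms(1)] assms by blast

text \<open>
  A cover \<open>\<rho> < \<tau>\<close> and the cover \<open>K < J\<close> of the join-irreducible \<open>J\<close> with the same arc are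
  perspective: \<open>J \<sqinter> \<rho> = K\<close> and \<open>J \<squnion> \<rho> = \<tau>\<close>. Meeting with \<open>J\<close> and joining with \<open>\<rho>\<close> carries one
  equivalence to the other.
\<close>

lemma cover_contracted_iff_join_irreducible:
  assumes C: "covers_via n \<rho> \<tau> a b S"
    and J: "J permutes {1..n}" "inversions n J = arc_inversions a b S"
    and K: "K permutes {1..n}" "inversions n K = arc_inversions a b S - {(b, a)}"
  shows "(\<rho>, \<tau>) \<in> R \<longleftrightarrow> (K, J) \<in> R"
proof
  have P: "\<rho> permutes {1..n}" "\<tau> permutes {1..n}"
    and ba: "(b, a) \<notin> inversions n \<rho>" "inversions n \<tau> = insert (b, a) (inversions n \<rho>)"
    using C by (auto simp: covers_via_def)
  have sub: "inversions n J \<subseteq> inversions n \<tau>"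
    using arc_inversions_subset[OF C] J by simp
  have baJ: "(b, a) \<in> inversions n J"
    using covers_via_valid[OF C] by (auto simp: J arc_inversions_def)
  {
    assume "(\<rho>, \<tau>) \<in> R"
    moreover have "is_meet n \<rho> J K"
      using sub ba J K by (auto simp: is_meet_def)
    moreover have "is_meet n \<tau> J J" by (rule is_meet_right[OF J(1) sub])
    ultimately show "(K, J) \<in> R" using R_meet J(1) by blast
  next
    assume "(K, J) \<in> R"
    moreover have "is_join n K \<rho> \<rho>"
      using sub ba J K P by (intro is_join_right) auto
    moreover have "is_join n J \<rho> \<tau>"
      using sub ba baJ P by (auto simp: is_join_def)
    ultimately show "(\<rho>, \<tau>) \<in> R" using R_join P(1) by blast
  }
qed

lemma same_arc_contracted_iff:
  assumes C: "covers_via n \<rho> \<tau> a b S" and C': "covers_via n \<rho>' \<tau>' a b S"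
  shows "(\<rho>, \<tau>) \<in> R \<longleftrightarrow> (\<rho>', \<tau>') \<in> R"
proof -
  note v = covers_via_valid[OF C]
  obtain J where J: "J permutes {1..n}" "inversions n J = arc_inversions a b S"
    using biclosed_arc_inversions(1)[OF v] by (rule exists_permutation_of_biclosed)
  obtain K where K: "K permutes {1..n}" "inversions n K = arc_inversions a b S - {(b, a)}"
    using biclosed_arc_inversions(2)[OF v] by (rule exists_permutation_of_biclosed)
  show ?thesis
    using cover_contracted_iff_join_irreducible[OF C J K]
      cover_contracted_iff_join_irreducible[OF C' J K] by simp
qed

text \<open>
  By the preceding lemma contraction is a property of the arc alone, and one witnessing cover is
  enough.
\<close>

definition contracted :: "nat \<Rightarrow> nat \<Rightarrow> nat set \<Rightarrow> bool" where
  "contracted a b S \<longleftrightarrow> (\<exists>\<rho> \<tau>. covers_via n \<rho> \<tau> a b S \<and> (\<rho>, \<tau>) \<in> R)"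

lemma contracted_iff:
  "covers_via n \<rho> \<tau> a b S \<Longrightarrow> contracted a b S \<longleftrightarrow> (\<rho>, \<tau>) \<in> R"
  using same_arc_contracted_iff unfolding contracted_def by blast

section \<open>Forcing between arcs\<close>

text \<open>
  An interval of six elements with the two maximal chains \<open>x0 < x1 < x2 < z\<close> and
  \<open>x0 < y1 < y2 < z\<close>, whose steps add \<open>p, r, q\<close> and \<open>q, r, p\<close>. Contracting the bottom edge that
  adds \<open>q\<close> contracts both middle edges, those that add \<open>r\<close>: joining with \<open>x1\<close> collapses
  \<open>x1, x2, z\<close>, and meeting with \<open>y2\<close> then collapses \<open>x0, y1, y2\<close>.
\<close>

lemma hexagon_forcing:
  assumes perms: "x0 permutes {1..n}" "x1 permutes {1..n}" "x2 permutes {1..n}"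
      "y1 permutes {1..n}" "y2 permutes {1..n}" "z permutes {1..n}"
    and inv: "inversions n x1 = insert p (inversions n x0)"
      "inversions n x2 = insert r (insert p (inversions n x0))"
      "inversions n y1 = insert q (inversions n x0)"
      "inversions n y2 = insert r (insert q (inversions n x0))"
      "inversions n z = insert r (insert q (insert p (inversions n x0)))"
    and new: "p \<notin> inversions n x0" "q \<notin> inversions n x0" "r \<notin> inversions n x0" "p \<noteq> q" "p \<noteq> r" "q \<noteq> r"
    and closed: "\<And>\<sigma>. \<sigma> permutes {1..n} \<Longrightarrow> p \<in> inversions n \<sigma> \<Longrightarrow> q \<in> inversions n \<sigma> \<Longrightarrow> r \<in> inversions n \<sigma>"
    and split: "\<And>\<sigma>. \<sigma> permutes {1..n} \<Longrightarrow> r \<in> inversions n \<sigma> \<Longrightarrow> p \<in> inversions n \<sigma> \<or> q \<in> inversions n \<sigma>"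
    and R: "(x0, y1) \<in> R"
  shows "(x1, x2) \<in> R" "(y1, y2) \<in> R"
proof -
  have "is_join n x0 x1 x1" using perms inv by (intro is_join_right) auto
  moreover have "is_join n y1 x1 z"
    using perms inv closed unfolding is_join_def by auto
  ultimately have x1z: "(x1, z) \<in> R" using R_join[OF R perms(2)] by blast
  thus x12: "(x1, x2) \<in> R" using perms inv by (elim R_between) auto
  have "(z, x2) \<in> R" using x1z x12 R_sym R_trans by blast
  moreover have "is_meet n z y2 y2" using perms inv by (intro is_meet_right) auto
  moreover have "is_meet n x2 y2 x0"
    unfolding is_meet_def
  proof (intro conjI allI impI)
    fix \<rho> assume \<rho>: "\<rho> permutes {1..n}" and sub: "inversions n \<rho> \<subseteq> inversions n x2 \<inter> inversions n y2"
    hence "p \<notin> inversions n \<rho>" "q \<notin> inversions n \<rho>" using inv new by auto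
    hence "r \<notin> inversions n \<rho>" using split \<rho> by blast
    thus "inversions n \<rho> \<subseteq> inversions n x0" using sub inv \<open>p \<notin> inversions n \<rho>\<close> by auto
  qed (use perms inv in auto)
  ultimately have "(y2, x0) \<in> R" using R_meet perms(5) by blast
  thus "(y1, y2) \<in> R" using R R_sym R_trans by blast
qed

text \<open>
  Three neighbouring values \<open>a < e < b\<close> of a permutation span a hexagon in the weak order. When the
  values of \<open>S - {e}\<close> are placed on the left, its bottom edges have the arcs from \<open>a\<close> to \<open>e\<close> and
  from \<open>e\<close> to \<open>b\<close>. Its middle edges have arcs from \<open>a\<close> to \<open>b\<close>, with \<open>e\<close> in the interior on the
  one side of the hexagon and outside on the other, so that one of them is \<open>(a, b, n, S)\<close>.
\<close>

lemma contracted_extend: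
  assumes ab: "1 \<le> a" "a < e" "e < b" "b \<le> n" and S: "S \<subseteq> {a<..<b}"
    and contr: "contracted a e (S \<inter> {a<..<e}) \<or> contracted e b (S \<inter> {e<..<b})"
  shows "contracted a b S"
proof -
  \<comment> \<open>Sorting by \<open>key i j l\<close> puts the values below \<open>a\<close> and those of \<open>S - {e}\<close> first and the remaining
    ones last. The keys \<open>i, j, l\<close> of \<open>a, e, b\<close> lie in between and run over the arrangements of
    \<open>2, 3, 4\<close>, which give the six vertices of the hexagon.\<close>
  define key :: "nat \<Rightarrow> nat \<Rightarrow> nat \<Rightarrow> nat \<Rightarrow> nat" where
    "key i j l v = (if v = a then i else if v = e then j else if v = b then l
       else if v < a \<or> v \<in> S then 0 else 5)" for i j l v
  define IN where "IN i j l = {(s, t). 1 \<le> t \<and> t < s \<and> s \<le> n \<and> key i j l s < key i j l t}" for i j l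
  have "\<exists>\<sigma>. \<sigma> permutes {1..n} \<and> inversions n \<sigma> = IN i j l" for i j l
    unfolding IN_def using exists_permutation_of_key[of n "key i j l"] by blast
  then obtain H where H: "H i j l permutes {1..n}" "inversions n (H i j l) = IN i j l" for i j l
    by metis
  \<comment> \<open>With equal middle keys, \<open>B\<close> collects the inversions common to all six vertices.\<close>
  define B where "B = {(s, t). 1 \<le> t \<and> t < s \<and> s \<le> n \<and> key 2 2 2 s < key 2 2 2 t}"
  have key_less_iff: "key i j l s < key i j l t \<longleftrightarrow>
      key 2 2 2 s < key 2 2 2 t \<or> s = b \<and> t = e \<and> l < j \<or> s = b \<and> t = a \<and> l < i \<or> s = e \<and> t = a \<and> j < i"
    if i: "0 < i" "i < 5" and j: "0 < j" "j < 5" and l: "0 < l" "l < 5" and st: "t < s"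
    for i j l s t
  proof -
    have middle: "key i j l a = i" "key i j l e = j" "key i j l b = l" for i j l
      using ab by (simp_all add: key_def)
    have outer: "key i j l v = key 2 2 2 v" "key 2 2 2 v = 0 \<or> key 2 2 2 v = 5"
      if "v \<noteq> a" "v \<noteq> e" "v \<noteq> b" for v
      using that by (simp_all add: key_def)
    have "s = b \<and> t = e \<or> s = b \<and> t = a \<or> s = e \<and> t = a" if "s \<in> {a, e, b}" "t \<in> {a, e, b}"
      using that st ab by auto
    then consider "s = b" "t = e" | "s = b" "t = a" | "s = e" "t = a"
      | "s \<in> {a, e, b}" "t \<notin> {a, e, b}" | "s \<notin> {a, e, b}" "t \<in> {a, e, b}"
      | "s \<notin> {a, e, b}" "t \<notin> {a, e, b}"
      by argo
    thus ?thesis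
    proof cases
      case 4
      have "0 < key i j l s" "key i j l s < 5" "key 2 2 2 s = 2"
        using 4(1) i j l middle by auto
      thus ?thesis using 4(2) outer[of t] by auto
    next
      case 5
      have "0 < key i j l t" "key i j l t < 5" "key 2 2 2 t = 2"
        using 5(2) i j l middle by auto
      thus ?thesis using 5(1) outer[of s] by auto
    next
      case 6
      thus ?thesis using outer(1)[of s] outer(1)[of t] by simp
    qed (use ab middle in auto)
  qed
  have IN_iff: "(s, t) \<in> IN i j l \<longleftrightarrow> (s, t) \<in> B \<or>
      s = b \<and> t = e \<and> l < j \<or> s = b \<and> t = a \<and> l < i \<or> s = e \<and> t = a \<and> j < i"
    if "0 < i" "i < 5" "0 < j" "j < 5" "0 < l" "l < 5" for i j l s t
    using key_less_iff[OF that, of t s] ab unfolding IN_def B_def by auto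
  have IN: "IN 2 3 4 = B" "IN 2 4 3 = insert (b, e) B"
    "IN 3 4 2 = insert (b, a) (insert (b, e) B)"
    "IN 3 2 4 = insert (e, a) B"
    "IN 4 2 3 = insert (b, a) (insert (e, a) B)"
    "IN 4 3 2 = insert (b, a) (insert (e, a) (insert (b, e) B))"
    by (auto simp: IN_iff)
  have new: "(b, e) \<notin> B" "(e, a) \<notin> B" "(b, a) \<notin> B"
    unfolding B_def key_def using ab by auto
  have S_bounds: "a < v \<and> v < b" if "v \<in> S" for v
    using that S by auto
  have B_lower: "(e, v) \<in> B \<longleftrightarrow> v \<notin> S" if "a < v" "v < e" for v
    using that ab S by (auto simp: B_def key_def)
  have B_upper: "(b, v) \<in> B \<longleftrightarrow> v \<notin> S \<and> v \<noteq> e" if "a < v" "v < b" for v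
    using that ab S by (auto simp: B_def key_def)
  have closed: "(b, e) \<in> inversions n \<sigma> \<Longrightarrow> (e, a) \<in> inversions n \<sigma> \<Longrightarrow> (b, a) \<in> inversions n \<sigma>"
    and split: "(b, a) \<in> inversions n \<sigma> \<Longrightarrow> (b, e) \<in> inversions n \<sigma> \<or> (e, a) \<in> inversions n \<sigma>"
    if "\<sigma> permutes {1..n}" for \<sigma>
    using biclosed_trans[OF biclosed_inversions[OF that]]
      biclosed_split[OF biclosed_inversions[OF that]] ab by blast+
  have left: "covers_via n (H 2 3 4) (H 3 2 4) a e (S \<inter> {a<..<e})"
    unfolding covers_via_def arc_interior_def using new ab H(1) by (auto simp: H(2) IN B_lower)
  have right: "covers_via n (H 2 3 4) (H 2 4 3) e b (S \<inter> {e<..<b})"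
    unfolding covers_via_def arc_interior_def using new ab H(1) by (auto simp: H(2) IN B_upper)
  have "(H 2 3 4, H 3 2 4) \<in> R \<or> (H 2 3 4, H 2 4 3) \<in> R"
    using contr contracted_iff[OF left] contracted_iff[OF right] by blast
  hence edges: "(H 2 4 3, H 3 4 2) \<in> R \<and> (H 3 2 4, H 4 2 3) \<in> R"
  proof
    assume R: "(H 2 3 4, H 3 2 4) \<in> R"
    show ?thesis
      by (intro conjI; rule hexagon_forcing[of "H 2 3 4" "H 2 4 3" "H 3 4 2" "H 3 2 4" "H 4 2 3"
            "H 4 3 2" "(b, e)" "(b, a)" "(e, a)"])
        (use R H(1) new ab in \<open>auto simp: H(2) IN dest: closed[simplified] split[simplified]\<close>)
  next
    assume R: "(H 2 3 4, H 2 4 3) \<in> R"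
    show ?thesis
      by (intro conjI; rule hexagon_forcing[of "H 2 3 4" "H 3 2 4" "H 4 2 3" "H 2 4 3" "H 3 4 2"
            "H 4 3 2" "(e, a)" "(b, a)" "(b, e)"])
        (use R H(1) new ab in \<open>auto simp: H(2) IN dest: closed[simplified] split[simplified]\<close>)
  qed
  show ?thesis
  proof (cases "e \<in> S")
    case True
    have "covers_via n (H 3 2 4) (H 4 2 3) a b S"
      unfolding covers_via_def arc_interior_def
    proof (intro conjI)
      show "S = {v. a < v \<and> v < b \<and> (b, v) \<notin> inversions n (H 4 2 3)}"
        using True S_bounds new ab by (auto simp: H(2) IN B_upper)
    qed (use H(1) new ab in \<open>auto simp: H(2) IN\<close>)
    thus ?thesis using edges contracted_def by blast
  next
    case False
    have "covers_via n (H 2 4 3) (H 3 4 2) a b S"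
      unfolding covers_via_def arc_interior_def
    proof (intro conjI)
      show "S = {v. a < v \<and> v < b \<and> (b, v) \<notin> inversions n (H 3 4 2)}"
        using False S_bounds new ab by (auto simp: H(2) IN B_upper)
    qed (use H(1) new ab in \<open>auto simp: H(2) IN\<close>)
    thus ?thesis using edges contracted_def by blast
  qed
qed

text \<open>
  Extend first the right endpoint of the arc, from \<open>e\<close> to \<open>b\<close>, and then the left one.
\<close>

lemma contracted_superarc:
  assumes "contracted c e (S \<inter> {c<..<e})" "1 \<le> a" "a \<le> c" "c < e" "e \<le> b" "b \<le> n" "S \<subseteq> {a<..<b}"
  shows "contracted a b S"
proof -
  have "contracted c b (S \<inter> {c<..<b})"
  proof (cases "e = b")
    case False
    moreover have "S \<inter> {c<..<b} \<inter> {c<..<e} = S \<inter> {c<..<e}" using assms by auto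
    ultimately show ?thesis using contracted_extend[of c e b "S \<inter> {c<..<b}"] assms by auto
  qed (use assms in simp)
  moreover have "S \<inter> {a<..<b} = S" using assms by auto
  ultimately show ?thesis
    using contracted_extend[of a c b S] assms by (cases "c = a") auto
qed

end

section \<open>Descents and join-irreducible permutations\<close>

lemma lower_arc_eq:
  assumes P: "\<sigma> permutes {1..n}" and ij: "1 \<le> i" "i < j" "j \<le> n" "\<sigma> j < \<sigma> i"
  shows "lower_arc n \<sigma> (i, j) = (\<sigma> j, \<sigma> i, n, arc_interior (inversions n \<sigma>) (\<sigma> i) (\<sigma> j))"
proof -
  have "(\<exists>k. v = \<sigma> k \<and> 1 \<le> k \<and> k < i) \<longleftrightarrow> (\<sigma> i, v) \<notin> inversions n \<sigma>"
    if v: "\<sigma> j < v" "v < \<sigma> i" for v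
  proof -
    have "1 \<le> v" "v \<le> n"
      using v permutes_interval_mem[OF P, of i] permutes_interval_mem[OF P, of j] ij by auto
    then obtain k where k: "1 \<le> k" "k \<le> n" "\<sigma> k = v"
      using permutes_interval_index[OF P] by metis
    have "k \<noteq> i" using k v by auto
    hence "(\<sigma> i, v) \<notin> inversions n \<sigma> \<longleftrightarrow> k < i"
      using mem_inversions_iff[OF P, of i k] k v ij by auto
    moreover have "(\<exists>m. v = \<sigma> m \<and> 1 \<le> m \<and> m < i) \<longleftrightarrow> k < i"
      using k permutes_inj[OF P] by (metis injD)
    ultimately show ?thesis by simp
  qed
  hence "{\<sigma> k |k. 1 \<le> k \<and> k < i \<and> \<sigma> k \<in> {\<sigma> j<..<\<sigma> i}} =
      arc_interior (inversions n \<sigma>) (\<sigma> i) (\<sigma> j)"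
    unfolding arc_interior_def greaterThanLessThan_iff by blast
  thus ?thesis by (simp add: lower_arc_def)
qed

lemma descentD:
  assumes "d \<in> descents n \<tau>"
  shows "1 \<le> d" "d < n" "\<tau> (d + 1) < \<tau> d"
  using assms by (auto simp: descents_def)

text \<open>
  The positions \<open>d\<close> and \<open>d + 1\<close> are adjacent, so any third value stands on the same side of both
  values. Hence deleting their inversion leaves a biclosed set.
\<close>

lemma exists_cover_at_descent:
  assumes P: "\<tau> permutes {1..n}" and d: "d \<in> descents n \<tau>"
  obtains \<rho> where
    "covers_via n \<rho> \<tau> (\<tau> (d + 1)) (\<tau> d) (arc_interior (inversions n \<tau>) (\<tau> d) (\<tau> (d + 1)))"
proof -
  let ?N = "inversions n \<tau>" and ?p = "(\<tau> d, \<tau> (d + 1))"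
  note d = descentD[OF d]
  have p: "?p \<in> ?N" using mem_inversions_iff[OF P, of d "d + 1"] d by simp
  note B = biclosed_inversions[OF P]
  note mem = mem_inversions_iff[OF P] and inj = inj_eq[OF permutes_inj[OF P]]
  have "biclosed n (?N - {?p})"
    unfolding biclosed_def
  proof (intro conjI allI impI)
    show "?N - {?p} \<subseteq> {(b, a). 1 \<le> a \<and> a < b \<and> b \<le> n}"
      using biclosed_bounds[OF B] by blast
  next
    fix c b a assume "(c, b) \<in> ?N - {?p}" "(b, a) \<in> ?N - {?p}"
    moreover from this have "(c, a) \<in> ?N" using biclosed_trans[OF B] by blast
    moreover have "(c, a) \<noteq> ?p"
    proof
      assume ca: "(c, a) = ?p"
      obtain k where "b = \<tau> k" using calculation by (auto elim: inversionsE)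
      hence "d < k" "k < d + 1" using calculation ca mem by auto
      thus False by simp
    qed
    ultimately show "(c, a) \<in> ?N - {?p}" by blast
  next
    fix c b a assume ca: "(c, a) \<in> ?N - {?p}" and "a < b" "b < c"
    then consider "(c, b) \<in> ?N" | "(b, a) \<in> ?N" using biclosed_split[OF B] by blast
    thus "(c, b) \<in> ?N - {?p} \<or> (b, a) \<in> ?N - {?p}"
    proof cases
      case 1
      have "(b, a) \<in> ?N" if cb: "(c, b) = ?p"
      proof -
        obtain i j where ij: "c = \<tau> i" "a = \<tau> j" "i < j" "1 \<le> i" "j \<le> n"
          using ca by (auto elim: inversionsE)
        hence "j \<noteq> d + 1" "i = d" using cb \<open>a < b\<close> inj by auto
        thus ?thesis using mem[of "d + 1" j] ij cb d \<open>a < b\<close> by auto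
      qed
      moreover have "(c, b) = ?p \<Longrightarrow> (b, a) \<noteq> ?p" using \<open>b < c\<close> by auto
      ultimately show ?thesis using 1 by blast
    next
      case 2
      have "(c, b) \<in> ?N" if ba: "(b, a) = ?p"
      proof -
        obtain i j where ij: "c = \<tau> i" "a = \<tau> j" "i < j" "1 \<le> i" "j \<le> n"
          using ca by (auto elim: inversionsE)
        hence "i \<noteq> d" "j = d + 1" using ba \<open>b < c\<close> inj by auto
        thus ?thesis using mem[of i d] ij ba d \<open>b < c\<close> by auto
      qed
      moreover have "(b, a) = ?p \<Longrightarrow> (c, b) \<noteq> ?p" using \<open>b < c\<close> by auto
      ultimately show ?thesis using 2 by blast
    qed
  qed
  then obtain \<rho> where "\<rho> permutes {1..n}" "inversions n \<rho> = ?N - {?p}"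
    by (rule exists_permutation_of_biclosed)
  hence "covers_via n \<rho> \<tau> (\<tau> (d + 1)) (\<tau> d) (arc_interior ?N (\<tau> d) (\<tau> (d + 1)))"
    using p P by (auto simp: covers_via_def)
  thus ?thesis by (rule that)
qed

text \<open>
  Among the inversions of \<open>\<tau>\<close> missing in \<open>\<pi>\<close>, one at minimal distance of positions is a descent: a
  value standing in between would yield a missing inversion at smaller distance.
\<close>

lemma exists_descent_not_inverted:
  assumes P: "\<pi> permutes {1..n}" and Q: "\<tau> permutes {1..n}"
    and sub: "inversions n \<pi> \<subset> inversions n \<tau>"
  obtains d where "d \<in> descents n \<tau>" "(\<tau> d, \<tau> (d + 1)) \<notin> inversions n \<pi>"
proof -
  note mem = mem_inversions_iff[OF Q]
  note B = biclosed_inversions[OF P]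
  let ?bad = "\<lambda>(i, j). (\<tau> i, \<tau> j) \<in> inversions n \<tau> - inversions n \<pi>"
  obtain x where "x \<in> inversions n \<tau> - inversions n \<pi>" using sub by blast
  moreover from this obtain i0 j0 where "x = (\<tau> i0, \<tau> j0)" by (auto elim: inversionsE)
  ultimately have "?bad (i0, j0)" by simp
  then obtain p where bad: "?bad p" and least: "\<And>q. ?bad q \<Longrightarrow> snd p - fst p \<le> snd q - fst q"
    using ex_has_least_nat[of ?bad "(i0, j0)" "\<lambda>p. snd p - fst p"] by auto
  obtain i j where p: "p = (i, j)" by (cases p)
  have ij: "1 \<le> i" "i < j" "j \<le> n" "\<tau> j < \<tau> i" "(\<tau> i, \<tau> j) \<notin> inversions n \<pi>"
    using bad p mem by auto
  have "j = i + 1"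
  proof (rule ccontr)
    assume "j \<noteq> i + 1"
    then obtain k where k: "i < k" "k < j" using ij(2) by (metis Suc_eq_plus1 Suc_lessI lessI)
    have shorter: "(\<tau> i, \<tau> k) \<in> inversions n \<pi>" if "\<tau> k < \<tau> i"
      using least[of "(i, k)"] mem[of i k] that k ij p by force
    have shorter': "(\<tau> k, \<tau> j) \<in> inversions n \<pi>" if "\<tau> j < \<tau> k"
      using least[of "(k, j)"] mem[of k j] that k ij p by force
    have "\<tau> k \<noteq> \<tau> i" "\<tau> k \<noteq> \<tau> j" using inj_eq[OF permutes_inj[OF Q]] k by auto
    then consider "\<tau> j < \<tau> k" "\<tau> k < \<tau> i" | "\<tau> i < \<tau> k" | "\<tau> k < \<tau> j" by linarith
    thus False
    proof cases
      case 1
      thus False using shorter shorter' biclosed_trans[OF B] ij by blast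
    next
      case 2
      hence "(\<tau> k, \<tau> i) \<in> inversions n \<pi>"
        using shorter' biclosed_split[OF B, of "\<tau> k" "\<tau> j" "\<tau> i"] ij by auto
      thus False using sub mem[of k i] k by auto
    next
      case 3
      hence "(\<tau> j, \<tau> k) \<in> inversions n \<pi>"
        using shorter biclosed_split[OF B, of "\<tau> i" "\<tau> k" "\<tau> j"] ij by auto
      thus False using sub mem[of j k] k by auto
    qed
  qed
  hence "i \<in> descents n \<tau>" "(\<tau> i, \<tau> (i + 1)) \<notin> inversions n \<pi>"
    using ij by (auto simp: descents_def)
  thus ?thesis by (rule that)
qed

text \<open>
  The permutation with inversion set \<^const>\<open>arc_inversions\<close> has \<open>b\<close> as the last value on its left side
  and \<open>a\<close> as the first one on its right side. All its inversions go from left to right, so the step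
  from \<open>b\<close> to \<open>a\<close> is the only descent.
\<close>

lemma exists_join_irreducible:
  assumes v: "1 \<le> a" "a < b" "b \<le> n" "S \<subseteq> {a<..<b}"
  obtains J d where "J permutes {1..n}" "descents n J = {d}" "J d = b" "J (d + 1) = a"
    "arc_interior (inversions n J) b a = S"
proof -
  obtain J where J: "J permutes {1..n}" "inversions n J = arc_inversions a b S"
    using biclosed_arc_inversions(1)[OF v] by (rule exists_permutation_of_biclosed)
  note mem = mem_inversions_iff[OF J(1), unfolded J(2)]
  have S: "a < s \<and> s < b" if "s \<in> S" for s using that v by auto
  obtain p where p: "1 \<le> p" "p \<le> n" "J p = b" using permutes_interval_index[OF J(1), of b] v by auto
  obtain q where q: "1 \<le> q" "q \<le> n" "J q = a" using permutes_interval_index[OF J(1), of a] v by auto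
  have "(J p, J q) \<in> arc_inversions a b S" using p q v by (auto simp: arc_inversions_def)
  hence pq: "p < q" using mem by blast
  have q_eq: "q = p + 1"
  proof (rule ccontr)
    assume "q \<noteq> p + 1"
    then obtain k where k: "p < k" "k < q" using pq by (metis Suc_eq_plus1 Suc_lessI lessI)
    have "J k \<noteq> b" "J k \<noteq> a" using inj_eq[OF permutes_inj[OF J(1)]] k p q by auto
    then consider "J k < b" "a < J k" | "J k < a" | "b < J k" by linarith
    thus False
    proof cases
      case 1
      hence "(b, J k) \<in> arc_inversions a b S" "(J k, a) \<in> arc_inversions a b S"
        using mem[of p k] mem[of k q] p q k by auto
      thus False using 1 v by (auto simp: arc_inversions_def)
    next
      case 2
      hence "(b, J k) \<in> arc_inversions a b S" using mem[of p k] p q k v by auto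
      thus False using 2 by (auto simp: arc_inversions_def)
    next
      case 3
      hence "(J k, a) \<in> arc_inversions a b S" using mem[of k q] p q k v by auto
      thus False using 3 S by (fastforce simp: arc_inversions_def)
    qed
  qed
  have "descents n J = {p}"
  proof (intro Set.set_eqI iffI)
    fix d assume "d \<in> descents n J"
    hence d: "1 \<le> d" "d < n" "J (d + 1) < J d" by (auto simp: descents_def)
    hence T: "(J d, J (d + 1)) \<in> arc_inversions a b S" using mem by simp
    have "d \<le> p"
    proof (rule ccontr)
      assume "\<not> d \<le> p"
      hence "J d \<noteq> b" using p inj_eq[OF permutes_inj[OF J(1)]] by auto
      hence "J d \<in> S" using T by (auto simp: arc_inversions_def)
      hence "(b, J d) \<in> arc_inversions a b S" using mem[of p d] p d S \<open>\<not> d \<le> p\<close> by auto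
      thus False using \<open>J d \<in> S\<close> S by (auto simp: arc_inversions_def)
    qed
    moreover have "q \<le> d + 1"
    proof (rule ccontr)
      assume "\<not> q \<le> d + 1"
      hence "J (d + 1) \<noteq> a" using q inj_eq[OF permutes_inj[OF J(1)]] by auto
      hence "J (d + 1) \<in> {a<..<b} - S" using T by (auto simp: arc_inversions_def)
      hence "(J (d + 1), a) \<in> arc_inversions a b S"
        using mem[of "d + 1" q] q d \<open>\<not> q \<le> d + 1\<close> by auto
      thus False using \<open>J (d + 1) \<in> {a<..<b} - S\<close> by (auto simp: arc_inversions_def)
    qed
    ultimately show "d \<in> {p}" using q_eq by simp
  qed (use p q q_eq v in \<open>auto simp: descents_def\<close>)
  moreover have "arc_interior (inversions n J) b a = S"
    using v S by (auto simp: arc_interior_def J(2) arc_inversions_def)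
  ultimately show ?thesis using that J p q q_eq by blast
qed

section \<open>Least elements of congruence classes\<close>

context weak_order_congruence
begin

text \<open>
  A class is closed under meets, so a member with fewest inversions lies below all others.
\<close>

lemma class_has_least:
  assumes "\<sigma> permutes {1..n}"
  obtains \<pi> where "(\<sigma>, \<pi>) \<in> R" "\<And>\<rho>. (\<sigma>, \<rho>) \<in> R \<Longrightarrow> inversions n \<pi> \<subseteq> inversions n \<rho>"
proof -
  obtain \<pi> where \<pi>: "(\<sigma>, \<pi>) \<in> R"
      and min: "\<And>\<rho>. (\<sigma>, \<rho>) \<in> R \<Longrightarrow> card (inversions n \<pi>) \<le> card (inversions n \<rho>)"
    using ex_has_least_nat[of "\<lambda>\<rho>. (\<sigma>, \<rho>) \<in> R" \<sigma> "\<lambda>\<rho>. card (inversions n \<rho>)"] R_refl[OF assms]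
    by blast
  have "inversions n \<pi> \<subseteq> inversions n \<rho>" if \<rho>: "(\<sigma>, \<rho>) \<in> R" for \<rho>
  proof -
    note P = R_permutes(2)[OF \<pi>] and Q = R_permutes(2)[OF \<rho>]
    obtain \<mu> where \<mu>: "is_meet n \<rho> \<pi> \<mu>" using exists_meet[OF Q P] .
    have "(\<rho>, \<pi>) \<in> R" using \<pi> \<rho> R_sym R_trans by blast
    hence "(\<mu>, \<pi>) \<in> R" using R_meet[OF _ P \<mu> is_meet_left[OF P]] by blast
    hence "card (inversions n \<pi>) \<le> card (inversions n \<mu>)"
      using min \<pi> R_sym R_trans by blast
    moreover have sub: "inversions n \<mu> \<subseteq> inversions n \<pi>" "inversions n \<mu> \<subseteq> inversions n \<rho>"
      using \<mu> by (auto simp: is_meet_def)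
    ultimately show ?thesis
      using card_seteq[OF finite_inversions[of n \<pi>] sub(1)] by simp
  qed
  with \<pi> show ?thesis by (rule that)
qed

lemma
  assumes P: "\<sigma> permutes {1..n}"
  shows pi_down_related: "(\<sigma>, pi_down n R \<sigma>) \<in> R"
    and pi_down_least: "(\<sigma>, \<rho>) \<in> R \<Longrightarrow> inversions n (pi_down n R \<sigma>) \<subseteq> inversions n \<rho>"
proof -
  obtain \<pi> where \<pi>: "(\<sigma>, \<pi>) \<in> R" "\<And>\<rho>. (\<sigma>, \<rho>) \<in> R \<Longrightarrow> inversions n \<pi> \<subseteq> inversions n \<rho>"
    using class_has_least[OF P] by blast
  have iff: "least (weak_order n) \<tau> (R `` {\<sigma>}) \<longleftrightarrow>
      (\<sigma>, \<tau>) \<in> R \<and> (\<forall>\<rho>. (\<sigma>, \<rho>) \<in> R \<longrightarrow> inversions n \<tau> \<subseteq> inversions n \<rho>)" for \<tau>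
    using R_permutes(2) by (auto simp: least_def weak_order_def)
  have "pi_down n R \<sigma> = \<pi>"
    unfolding pi_down_def class_min_def iff
  proof (rule the_equality)
    fix \<tau> assume \<tau>: "(\<sigma>, \<tau>) \<in> R \<and> (\<forall>\<rho>. (\<sigma>, \<rho>) \<in> R \<longrightarrow> inversions n \<tau> \<subseteq> inversions n \<rho>)"
    hence "inversions n \<tau> = inversions n \<pi>" using \<pi> by blast
    thus "\<tau> = \<pi>" using inversions_inject R_permutes(2) \<tau> \<pi>(1) by blast
  qed (use \<pi> in blast)
  thus "(\<sigma>, pi_down n R \<sigma>) \<in> R"
    "(\<sigma>, \<rho>) \<in> R \<Longrightarrow> inversions n (pi_down n R \<sigma>) \<subseteq> inversions n \<rho>"
    using \<pi> by auto
qed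

text \<open>
  The step down the class: classes are convex, so a lower cover of \<open>\<tau>\<close> above \<open>\<pi>\<close> stays in the class.
\<close>

lemma exists_contracted_cover:
  assumes R: "(\<pi>, \<tau>) \<in> R" and sub: "inversions n \<pi> \<subset> inversions n \<tau>"
  obtains d \<rho> where "d \<in> descents n \<tau>"
    "covers_via n \<rho> \<tau> (\<tau> (d + 1)) (\<tau> d) (arc_interior (inversions n \<tau>) (\<tau> d) (\<tau> (d + 1)))"
    "inversions n \<pi> \<subseteq> inversions n \<rho>" "(\<rho>, \<tau>) \<in> R"
proof -
  note P = R_permutes[OF R]
  obtain d where d: "d \<in> descents n \<tau>" "(\<tau> d, \<tau> (d + 1)) \<notin> inversions n \<pi>"
    using exists_descent_not_inverted[OF P sub] .
  obtain \<rho> where \<rho>: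
    "covers_via n \<rho> \<tau> (\<tau> (d + 1)) (\<tau> d) (arc_interior (inversions n \<tau>) (\<tau> d) (\<tau> (d + 1)))"
    using exists_cover_at_descent[OF P(2) d(1)] .
  have "inversions n \<pi> \<subseteq> inversions n \<rho>" "inversions n \<rho> \<subseteq> inversions n \<tau>" "\<rho> permutes {1..n}"
    using \<rho> sub d(2) by (auto simp: covers_via_def)
  moreover from this have "(\<rho>, \<tau>) \<in> R" using R_between[OF R] R R_sym R_trans by blast
  ultimately show ?thesis using that d \<rho> by blast
qed

lemma pi_down_fixed_iff:
  assumes P: "\<sigma> permutes {1..n}"
  shows "pi_down n R \<sigma> = \<sigma> \<longleftrightarrow>
    (\<forall>d \<in> descents n \<sigma>. \<not> contracted (\<sigma> (d + 1)) (\<sigma> d) (arc_interior (inversions n \<sigma>) (\<sigma> d) (\<sigma> (d + 1))))"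
    (is "?fixed \<longleftrightarrow> ?none")
proof
  assume fixed: ?fixed
  show ?none
  proof (rule ballI, rule notI)
    fix d assume "d \<in> descents n \<sigma>"
      and c: "contracted (\<sigma> (d + 1)) (\<sigma> d) (arc_interior (inversions n \<sigma>) (\<sigma> d) (\<sigma> (d + 1)))"
    then obtain \<rho> where \<rho>:
      "covers_via n \<rho> \<sigma> (\<sigma> (d + 1)) (\<sigma> d) (arc_interior (inversions n \<sigma>) (\<sigma> d) (\<sigma> (d + 1)))"
      using exists_cover_at_descent[OF P] by blast
    hence "(\<sigma>, \<rho>) \<in> R" using c contracted_iff R_sym by blast
    hence "inversions n \<sigma> \<subseteq> inversions n \<rho>" using pi_down_least[OF P] fixed by auto
    thus False using \<rho> by (auto simp: covers_via_def)
  qed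
next
  assume none: ?none
  show ?fixed
  proof (rule ccontr)
    assume neq: "\<not> ?fixed"
    have R: "(pi_down n R \<sigma>, \<sigma>) \<in> R" using pi_down_related[OF P] by (rule R_sym)
    moreover have "inversions n (pi_down n R \<sigma>) \<subset> inversions n \<sigma>"
      using pi_down_least[OF P R_refl[OF P]] neq inversions_inject R_permutes[OF R] by blast
    ultimately show False
      by (rule exists_contracted_cover) (use none contracted_def in blast)
  qed
qed

text \<open>
  Every arc belongs to some join-irreducible permutation, whose only lower cover has this arc. That
  permutation is least in its class iff the cover is not contracted.
\<close>

lemma mem_congruence_arcs_iff:
  "(a, b, m, S) \<in> congruence_arcs n R \<longleftrightarrow>
     m = n \<and> 1 \<le> a \<and> a < b \<and> b \<le> n \<and> S \<subseteq> {a<..<b} \<and> \<not> contracted a b S"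
proof
  assume "(a, b, m, S) \<in> congruence_arcs n R"
  then obtain \<sigma> d where \<sigma>: "\<sigma> permutes {1..n}" "descents n \<sigma> = {d}" "pi_down n R \<sigma> = \<sigma>"
      and arc: "(a, b, m, S) = lower_arc n \<sigma> (d, d + 1)"
    unfolding congruence_arcs_def by blast
  hence d: "d \<in> descents n \<sigma>" by simp
  have "(a, b, m, S) = (\<sigma> (d + 1), \<sigma> d, n, arc_interior (inversions n \<sigma>) (\<sigma> d) (\<sigma> (d + 1)))"
    unfolding arc by (rule lower_arc_eq[OF \<sigma>(1)]) (use descentD[OF d] in auto)
  hence eq: "m = n" "a = \<sigma> (d + 1)" "b = \<sigma> d" "S = arc_interior (inversions n \<sigma>) (\<sigma> d) (\<sigma> (d + 1))"
    by auto
  obtain \<rho> where "covers_via n \<rho> \<sigma> a b S"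
    unfolding eq using exists_cover_at_descent[OF \<sigma>(1) d] .
  moreover have "\<not> contracted a b S" unfolding eq using pi_down_fixed_iff[OF \<sigma>(1)] \<sigma>(3) d by blast
  ultimately show "m = n \<and> 1 \<le> a \<and> a < b \<and> b \<le> n \<and> S \<subseteq> {a<..<b} \<and> \<not> contracted a b S"
    using covers_via_valid[of n \<rho> \<sigma> a b S] eq(1) by simp
next
  assume asm: "m = n \<and> 1 \<le> a \<and> a < b \<and> b \<le> n \<and> S \<subseteq> {a<..<b} \<and> \<not> contracted a b S"
  hence v: "1 \<le> a" "a < b" "b \<le> n" "S \<subseteq> {a<..<b}" by auto
  obtain J d where J: "J permutes {1..n}" "descents n J = {d}" "J d = b" "J (d + 1) = a"
    "arc_interior (inversions n J) b a = S"
    using exists_join_irreducible[OF v] .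
  hence d: "d \<in> descents n J" by simp
  have "lower_arc n J (d, d + 1) = (a, b, n, S)"
    using lower_arc_eq[OF J(1), of d "d + 1"] descentD[OF d] J by simp
  moreover have "pi_down n R J = J"
    unfolding pi_down_fixed_iff[OF J(1)] using J asm by simp
  ultimately show "(a, b, m, S) \<in> congruence_arcs n R"
    unfolding congruence_arcs_def mem_Collect_eq using J asm
    by (intro exI[of _ J] exI[of _ d]) simp
qed

end

section \<open>The diagram of maximal boxes along a cover\<close>

text \<open>
  Boxes, their arcs and the order \<open>\<prec>\<close> depend on the inversion set \<open>N\<close> only, once the box \<open>(i, j)\<close> is
  recorded by its values \<open>(\<sigma>\<^sub>i, \<sigma>\<^sub>j)\<close>. This makes the effect of deleting one inversion visible.
\<close>

definition value_boxes :: "(nat \<times> nat) set \<Rightarrow> (nat \<times> nat) set" where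
  "value_boxes N = {(b, a) \<in> N. \<forall>v. a < v \<longrightarrow> v < b \<longrightarrow> (b, v) \<notin> N \<or> (v, a) \<notin> N}"

definition value_arc :: "nat \<Rightarrow> (nat \<times> nat) set \<Rightarrow> nat \<times> nat \<Rightarrow> arc" where
  "value_arc n N = (\<lambda>(b, a). (a, b, n, arc_interior N b a))"

text \<open>
  For \<open>b \<le> d\<close>, the condition \<open>(d, b) \<notin> N\<close> says that \<open>b\<close> stands weakly left of \<open>d\<close>; likewise for
  \<open>c \<le> a\<close>.
\<close>

definition value_box_le :: "(nat \<times> nat) set \<Rightarrow> nat \<times> nat \<Rightarrow> nat \<times> nat \<Rightarrow> bool" where
  "value_box_le N = (\<lambda>(b, a) (d, c). c \<le> a \<and> b \<le> d \<and> (d, b) \<notin> N \<and> (a, c) \<notin> N)"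

definition value_boxes_in :: "nat \<Rightarrow> arc set \<Rightarrow> (nat \<times> nat) set \<Rightarrow> (nat \<times> nat) set" where
  "value_boxes_in n \<I> N = {p \<in> value_boxes N. value_arc n N p \<in> \<I>}"

definition value_diagram :: "nat \<Rightarrow> arc set \<Rightarrow> (nat \<times> nat) set \<Rightarrow> arc set" where
  "value_diagram n \<I> N =
     value_arc n N ` {p \<in> value_boxes_in n \<I> N. \<forall>q \<in> value_boxes_in n \<I> N. value_box_le N p q \<longrightarrow> q = p}"

definition subarc_closed :: "nat \<Rightarrow> arc set \<Rightarrow> bool" where
  "subarc_closed n \<I> \<longleftrightarrow>
     (\<forall>a b S c e. (a, b, n, S) \<in> \<I> \<longrightarrow> a \<le> c \<longrightarrow> c < e \<longrightarrow> e \<le> b \<longrightarrow> (c, e, n, S \<inter> {c<..<e}) \<in> \<I>)"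

lemma subarc_closedD:
  "subarc_closed n \<I> \<Longrightarrow> (a, b, n, S) \<in> \<I> \<Longrightarrow> a \<le> c \<Longrightarrow> c < e \<Longrightarrow> e \<le> b \<Longrightarrow> T = S \<inter> {c<..<e} \<Longrightarrow>
     (c, e, n, T) \<in> \<I>"
  by (auto simp: subarc_closed_def)

text \<open>
  Moving \<open>y\<close> in front of its left neighbour \<open>x\<close> affects only boxes at \<open>x\<close> or \<open>y\<close>. The box \<open>(x, y)\<close>
  itself disappears, and its arc is not in \<open>\<I>\<close>. New boxes \<open>(x, a)\<close> with \<open>a < y\<close> and \<open>(b, y)\<close> with
  \<open>x < b\<close> may appear, but their arcs contain the arc of \<open>(x, y)\<close> as a subarc and so are not in \<open>\<I>\<close>
  either. A comparison of boxes that changes would involve one of these new boxes. Hence the boxes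
  with arc in \<open>\<I>\<close>, their arcs and their order all stay the same.
\<close>

lemma value_diagram_delete:
  assumes N: "biclosed n N" and M: "biclosed n M"
    and NM: "N = insert (x, y) M" and xy: "(x, y) \<notin> M"
    and closed: "subarc_closed n \<I>" and out: "value_arc n N (x, y) \<notin> \<I>"
  shows "value_diagram n \<I> M = value_diagram n \<I> N"
proof -
  have yx: "y < x" using biclosed_bounds[OF N, of x y] NM by auto
  have out': "(y, x, n, arc_interior N x y) \<notin> \<I>" using out by (simp add: value_arc_def)
  have no_right: "(x, a) \<notin> M" if "(y, a) \<notin> M" "a < y" for a
    using that biclosed_split[OF M, of x a y] xy yx by auto
  have no_left: "(b, y) \<notin> M" if "(b, x) \<notin> M" "x < b" for b
    using that biclosed_split[OF M, of b y x] xy yx by auto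
  have box_N: "(b, a) \<in> value_boxes M \<and> arc_interior M b a = arc_interior N b a"
    if box: "(b, a) \<in> value_boxes N" and ne: "(b, a) \<noteq> (x, y)" for b a
  proof
    have ba: "(b, a) \<in> M" using box ne NM by (auto simp: value_boxes_def)
    thus "(b, a) \<in> value_boxes M" using box NM by (auto simp: value_boxes_def)
    have "(b, v) \<noteq> (x, y)" if "a < v" "v < b" for v
    proof
      assume "(b, v) = (x, y)"
      hence "(y, a) \<notin> M" "(x, a) \<in> M" "a < y" using box that ba NM by (auto simp: value_boxes_def)
      thus False using no_right by blast
    qed
    thus "arc_interior M b a = arc_interior N b a"
      unfolding arc_interior_def NM by blast
  qed
  have no_x: "\<not> (a < y \<and> b = x)"
    if box: "(b, a) \<in> value_boxes M" and I: "value_arc n M (b, a) \<in> \<I>" for b a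
  proof
    assume bx: "a < y \<and> b = x"
    have "arc_interior N x y = arc_interior M x a \<inter> {y<..<x}"
      using bx yx NM by (auto simp: arc_interior_def)
    hence "(y, x, n, arc_interior N x y) \<in> \<I>"
      using subarc_closedD[OF closed, of a x "arc_interior M x a" y x] I bx yx
      by (simp add: value_arc_def)
    thus False using out' by blast
  qed
  have no_y: "\<not> (x < b \<and> a = y)"
    if box: "(b, a) \<in> value_boxes M" and I: "value_arc n M (b, a) \<in> \<I>" for b a
  proof
    assume ay: "x < b \<and> a = y"
    hence bx: "(b, x) \<in> M" using box no_left by (auto simp: value_boxes_def)
    have "(b, v) \<in> M \<longleftrightarrow> (x, v) \<in> N" if v: "y < v" "v < x" for v
    proof
      assume bv: "(b, v) \<in> M"
      hence "(v, y) \<notin> M" using box ay v by (auto simp: value_boxes_def)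
      hence "(v, y) \<notin> N" using v NM by auto
      thus "(x, v) \<in> N" using biclosed_split[OF N, of x y v] v NM by auto
    next
      assume "(x, v) \<in> N"
      hence "(x, v) \<in> M" using v NM by auto
      thus "(b, v) \<in> M" using bx biclosed_trans[OF M] by blast
    qed
    hence "arc_interior N x y = arc_interior M b y \<inter> {y<..<x}"
      using ay yx by (auto simp: arc_interior_def)
    hence "(y, x, n, arc_interior N x y) \<in> \<I>"
      using subarc_closedD[OF closed, of y b "arc_interior M b y" y x] I ay yx
      by (simp add: value_arc_def)
    thus False using out' by blast
  qed
  have box_M: "(b, a) \<in> value_boxes N \<and> arc_interior M b a = arc_interior N b a"
    if box: "(b, a) \<in> value_boxes M" and I: "value_arc n M (b, a) \<in> \<I>" for b a
  proof
    have ba: "(b, a) \<in> M" using box by (simp add: value_boxes_def)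
    have ne: "(b, v) \<noteq> (x, y) \<and> (v, a) \<noteq> (x, y)" if "a < v" "v < b" for v
      using no_x[OF box I] no_y[OF box I] that by auto
    have "(b, v) \<notin> N \<or> (v, a) \<notin> N" if "a < v" "v < b" for v
      using ne[OF that] box that NM by (auto simp: value_boxes_def)
    thus "(b, a) \<in> value_boxes N" using ba NM by (auto simp: value_boxes_def)
    show "arc_interior M b a = arc_interior N b a"
      unfolding arc_interior_def NM using ne by blast
  qed
  have boxes: "value_boxes_in n \<I> M = value_boxes_in n \<I> N"
  proof -
    have "p \<in> value_boxes_in n \<I> M \<longleftrightarrow> p \<in> value_boxes_in n \<I> N" for p
    proof (cases p)
      case (Pair b a)
      have "(b, a) \<noteq> (x, y)" if "value_arc n N (b, a) \<in> \<I>" using that out by auto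
      thus ?thesis
        using box_N[of b a] box_M[of b a]
        unfolding Pair value_boxes_in_def value_arc_def by auto
    qed
    thus ?thesis by blast
  qed
  have arcs: "value_arc n M p = value_arc n N p" if "p \<in> value_boxes_in n \<I> M" for p
    using that box_M by (cases p) (auto simp: value_boxes_in_def value_arc_def)
  have le: "value_box_le M p q \<longleftrightarrow> value_box_le N p q"
    if p: "p \<in> value_boxes_in n \<I> M" and q: "q \<in> value_boxes_in n \<I> M" for p q
  proof -
    obtain b a d c where pq: "p = (b, a)" "q = (d, c)" by (cases p, cases q)
    have M_mem: "(b, a) \<in> M" "(d, c) \<in> M"
      using p q by (auto simp: pq value_boxes_in_def value_boxes_def)
    have "a < b" "c < d" using M_mem biclosed_bounds[OF M] by blast+
    have qM: "(d, c) \<in> value_boxes M" "value_arc n M (d, c) \<in> \<I>"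
      using q by (auto simp: pq value_boxes_in_def)
    have "(d, b) \<noteq> (x, y) \<and> (a, c) \<noteq> (x, y)" if "c \<le> a" "b \<le> d"
      using no_x[OF qM] no_y[OF qM] that \<open>a < b\<close> by auto
    thus ?thesis unfolding value_box_le_def pq NM by auto
  qed
  show ?thesis
    unfolding value_diagram_def
  proof (rule image_cong)
    show "{p \<in> value_boxes_in n \<I> M. \<forall>q\<in>value_boxes_in n \<I> M. value_box_le M p q \<longrightarrow> q = p} =
      {p \<in> value_boxes_in n \<I> N. \<forall>q\<in>value_boxes_in n \<I> N. value_box_le N p q \<longrightarrow> q = p}"
      using le boxes by auto
  qed (use arcs boxes in auto)
qed

section \<open>Diagrams of descents\<close>

text \<open>
  For descents \<open>i < j\<close>, a point \<open>r\<close> of the first arc that is not in \<open>B\<close> would be a value at a position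
  at most \<open>i + 1 \<le> j\<close>. All values in \<open>{c..d}\<close> at positions before \<open>j\<close> lie in \<open>B\<close>, so \<open>r\<close> is
  \<open>\<sigma>\<^sub>j\<close> with \<open>j = i + 1\<close>, a common endpoint of both arcs. The cases \<open>i < j\<close> and \<open>j < i\<close> use the
  two conjuncts in the definition of crossing.
\<close>

lemma lower_diagram_noncrossing:
  assumes P: "\<sigma> permutes {1..n}"
  shows "noncrossing_arc_diagram n (lower_diagram n \<sigma>)"
proof -
  note inj = inj_eq[OF permutes_inj[OF P]]
  have ncross: "\<not> (\<exists>r. r \<in> ({a..b} \<inter> {c..d}) - ({a, b} \<inter> {c, d}) \<and> r \<in> (A \<union> {a, b}) - B)"
    if ij: "1 \<le> i" "i < j" "j < n" and A: "lower_arc n \<sigma> (i, i + 1) = (a, b, n, A)"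
      and B: "lower_arc n \<sigma> (j, j + 1) = (c, d, n, B)" for i j a b c d A B
  proof
    assume "\<exists>r. r \<in> ({a..b} \<inter> {c..d}) - ({a, b} \<inter> {c, d}) \<and> r \<in> (A \<union> {a, b}) - B"
    then obtain r where r: "r \<in> {c..d}" "r \<notin> {a, b} \<inter> {c, d}" "r \<in> A \<union> {a, b}" "r \<notin> B" by auto
    have eqs: "a = \<sigma> (i + 1)" "b = \<sigma> i" "c = \<sigma> (j + 1)" "d = \<sigma> j"
      and A_eq: "A = {\<sigma> k |k. 1 \<le> k \<and> k < i \<and> \<sigma> k \<in> {a<..<b}}"
      and B_eq: "B = {\<sigma> k |k. 1 \<le> k \<and> k < j \<and> \<sigma> k \<in> {c<..<d}}"
      using A B by (auto simp: lower_arc_def)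
    obtain k where k: "1 \<le> k" "k \<le> i + 1" "r = \<sigma> k"
      using r(3) ij unfolding A_eq eqs by auto
    have "\<not> (k < j \<and> r \<noteq> c \<and> r \<noteq> d)"
    proof
      assume *: "k < j \<and> r \<noteq> c \<and> r \<noteq> d"
      hence "r \<in> {c<..<d}" using r(1) by auto
      hence "r \<in> B" unfolding B_eq using k * by blast
      thus False using r(4) by simp
    qed
    moreover have "r \<noteq> c" using k ij by (auto simp: eqs inj)
    moreover have "k = j" if "\<not> k < j" using that k ij by simp
    ultimately have "r = d" using k(3) eqs(4) by blast
    hence "k = i + 1" using k ij by (auto simp: eqs inj)
    thus False using r(2) \<open>r = d\<close> k by (auto simp: eqs)
  qed
  have arc: "lower_arc n \<sigma> (i, i + 1) \<in> arcs n" if i: "i \<in> descents n \<sigma>" for i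
    using i permutes_interval_mem[OF P, of i] permutes_interval_mem[OF P, of "i + 1"]
    by (auto simp: descents_def arcs_def lower_arc_def)
  have apart: "\<not> arcs_cross (lower_arc n \<sigma> (i, i + 1)) (lower_arc n \<sigma> (j, j + 1))"
    if "i \<in> descents n \<sigma>" "j \<in> descents n \<sigma>" "i \<noteq> j" for i j
  proof -
    obtain a b A where A: "lower_arc n \<sigma> (i, i + 1) = (a, b, n, A)" by (simp add: lower_arc_def)
    obtain c d B where B: "lower_arc n \<sigma> (j, j + 1) = (c, d, n, B)" by (simp add: lower_arc_def)
    have ij: "1 \<le> i" "i < n" "1 \<le> j" "j < n" using that by (auto simp: descents_def)
    from \<open>i \<noteq> j\<close> consider "i < j" | "j < i" by linarith
    thus ?thesis
    proof cases
      case 1 thus ?thesis using ncross[OF ij(1) 1 ij(4) A B] unfolding A B arcs_cross.simps by blast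
    next
      case 2 thus ?thesis using ncross[OF ij(3) 2 ij(2) B A] unfolding A B arcs_cross.simps by blast
    qed
  qed
  show ?thesis
    unfolding noncrossing_arc_diagram_def
  proof (intro conjI ballI impI)
    show "lower_diagram n \<sigma> \<subseteq> arcs n" using arc by (auto simp: lower_diagram_def)
  next
    fix \<alpha> \<beta> assume "\<alpha> \<in> lower_diagram n \<sigma>" "\<beta> \<in> lower_diagram n \<sigma>" and neq: "\<alpha> \<noteq> \<beta>"
    then obtain i j where i: "i \<in> descents n \<sigma>" "\<alpha> = lower_arc n \<sigma> (i, i + 1)"
      and j: "j \<in> descents n \<sigma>" "\<beta> = lower_arc n \<sigma> (j, j + 1)"
      unfolding lower_diagram_def by blast
    have ij: "i \<noteq> j" using neq i j by blast
    thus "\<not> arcs_cross \<alpha> \<beta>" using apart i j by blast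
    show "fst \<alpha> \<noteq> fst \<beta>" "fst (snd \<alpha>) \<noteq> fst (snd \<beta>)"
      using ij by (simp_all add: i j lower_arc_def inj)
  qed
qed

text \<open>
  No value of an empty box \<open>(i, j)\<close> lies between \<open>\<sigma>\<^sub>j\<close> and \<open>\<sigma>\<^sub>i\<close>, so the values must jump
  from at least \<open>\<sigma>\<^sub>i\<close> to at most \<open>\<sigma>\<^sub>j\<close> in one step. This descent is a box above \<open>(i, j)\<close>.
\<close>

lemma maximal_boxes_eq_descents:
  assumes P: "\<sigma> permutes {1..n}"
    and I: "\<And>d. d \<in> descents n \<sigma> \<Longrightarrow> lower_arc n \<sigma> (d, d + 1) \<in> \<I>"
  shows "maximal_boxes n \<I> \<sigma> = {(d, d + 1) | d. d \<in> descents n \<sigma>}"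
proof (intro equalityI subsetI)
  fix p assume p: "p \<in> maximal_boxes n \<I> \<sigma>"
  then obtain i j where ij: "p = (i, j)" "1 \<le> i" "i < j" "j \<le> n" "\<sigma> j < \<sigma> i"
      and empty: "\<sigma> ` {i<..<j} \<inter> {\<sigma> j<..<\<sigma> i} = {}"
    by (auto simp: maximal_boxes_def Let_def empty_boxes_def)
  \<comment> \<open>the last position before \<open>j\<close> with a value at or above \<open>\<sigma> i\<close>\<close>
  define k where "k = Max {k \<in> {i..<j}. \<sigma> i \<le> \<sigma> k}"
  have "k \<in> {k \<in> {i..<j}. \<sigma> i \<le> \<sigma> k}"
    unfolding k_def by (rule Max_in) (use ij in auto)
  hence k: "i \<le> k" "k < j" "\<sigma> i \<le> \<sigma> k" by auto
  have k_max: "m \<le> k" if "m \<in> {i..<j}" "\<sigma> i \<le> \<sigma> m" for m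
    unfolding k_def by (rule Max_ge) (use that in auto)
  have next_le: "\<sigma> (k + 1) \<le> \<sigma> j"
  proof (cases "k + 1 = j")
    case False
    hence "k + 1 \<in> {i<..<j}" using k by auto
    moreover from this have "\<sigma> (k + 1) < \<sigma> i" using k_max[of "k + 1"] by fastforce
    ultimately show ?thesis using empty by fastforce
  qed simp
  have d: "k \<in> descents n \<sigma>" using ij k next_le by (auto simp: descents_def)
  hence "(k, k + 1) \<in> empty_boxes n \<sigma>" by (auto simp: descents_def empty_boxes_def)
  moreover have "box_le \<sigma> p (k, k + 1)" using ij k next_le by (auto simp: box_le_def)
  ultimately have "(k, k + 1) = p"
    using p I[OF d] by (auto simp: maximal_boxes_def Let_def)
  thus "p \<in> {(d, d + 1) | d. d \<in> descents n \<sigma>}" using d by auto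
next
  fix p assume "p \<in> {(d, d + 1) | d. d \<in> descents n \<sigma>}"
  then obtain d where "p = (d, d + 1)" "d \<in> descents n \<sigma>" by auto
  thus "p \<in> maximal_boxes n \<I> \<sigma>"
    using I[of d] by (auto simp: maximal_boxes_def Let_def empty_boxes_def descents_def box_le_def)
qed

section \<open>Diagrams of congruence classes\<close>

text \<open>
  The map \<open>(i, j) \<mapsto> (\<sigma>\<^sub>i, \<sigma>\<^sub>j)\<close> translates from positions to values.
\<close>

lemma lower_arcs_maximal_boxes_eq:
  assumes P: "\<sigma> permutes {1..n}"
  shows "{lower_arc n \<sigma> (i, j) | i j. (i, j) \<in> maximal_boxes n \<I> \<sigma>} =
    value_diagram n \<I> (inversions n \<sigma>)"
proof -
  let ?N = "inversions n \<sigma>" and ?f = "\<lambda>(i, j). (\<sigma> i, \<sigma> j)"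
  define X where "X = {p \<in> empty_boxes n \<sigma>. lower_arc n \<sigma> p \<in> \<I>}"
  note mem = mem_inversions_iff[OF P]
  have box_iff: "(i, j) \<in> empty_boxes n \<sigma> \<longleftrightarrow> (\<sigma> i, \<sigma> j) \<in> value_boxes ?N" for i j
  proof (cases "(\<sigma> i, \<sigma> j) \<in> ?N")
    case True
    hence ij: "1 \<le> i" "i < j" "j \<le> n" "\<sigma> j < \<sigma> i" using mem by auto
    have between: "(\<forall>k. i < k \<longrightarrow> k < j \<longrightarrow> \<not> (\<sigma> j < \<sigma> k \<and> \<sigma> k < \<sigma> i)) \<longleftrightarrow>
        (\<forall>v. \<sigma> j < v \<longrightarrow> v < \<sigma> i \<longrightarrow> (\<sigma> i, v) \<notin> ?N \<or> (v, \<sigma> j) \<notin> ?N)"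
    proof (intro iffI allI impI)
      fix v assume empty: "\<forall>k. i < k \<longrightarrow> k < j \<longrightarrow> \<not> (\<sigma> j < \<sigma> k \<and> \<sigma> k < \<sigma> i)"
        and v: "\<sigma> j < v" "v < \<sigma> i"
      have "1 \<le> v" "v \<le> n"
        using v permutes_interval_mem[OF P, of i] permutes_interval_mem[OF P, of j] ij by auto
      then obtain k where "\<sigma> k = v" using permutes_interval_index[OF P] by metis
      thus "(\<sigma> i, v) \<notin> ?N \<or> (v, \<sigma> j) \<notin> ?N" using mem empty v by blast
    next
      fix k assume none: "\<forall>v. \<sigma> j < v \<longrightarrow> v < \<sigma> i \<longrightarrow> (\<sigma> i, v) \<notin> ?N \<or> (v, \<sigma> j) \<notin> ?N"
        and k: "i < k" "k < j"
      show "\<not> (\<sigma> j < \<sigma> k \<and> \<sigma> k < \<sigma> i)"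
      proof
        assume s: "\<sigma> j < \<sigma> k \<and> \<sigma> k < \<sigma> i"
        hence "(\<sigma> i, \<sigma> k) \<in> ?N" "(\<sigma> k, \<sigma> j) \<in> ?N" using mem[of i k] mem[of k j] k ij by auto
        thus False using none s by blast
      qed
    qed
    have "(i, j) \<in> empty_boxes n \<sigma> \<longleftrightarrow>
        (\<forall>k. i < k \<longrightarrow> k < j \<longrightarrow> \<not> (\<sigma> j < \<sigma> k \<and> \<sigma> k < \<sigma> i))"
      using ij by (fastforce simp: empty_boxes_def)
    thus ?thesis using between True unfolding value_boxes_def by simp
  next
    case False
    thus ?thesis using mem[of i j] by (auto simp: empty_boxes_def value_boxes_def)
  qed
  have box_arc: "lower_arc n \<sigma> p = value_arc n ?N (?f p)" if "p \<in> empty_boxes n \<sigma>" for p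
    using that lower_arc_eq[OF P] by (auto simp: empty_boxes_def value_arc_def)
  have box_le: "box_le \<sigma> p q \<longleftrightarrow> value_box_le ?N (?f p) (?f q)"
    if "p \<in> empty_boxes n \<sigma>" "q \<in> empty_boxes n \<sigma>" for p q
  proof -
    obtain i j k l where pq: "p = (i, j)" "q = (k, l)" by (cases p, cases q)
    have ij: "1 \<le> i" "i < j" "j \<le> n" "\<sigma> j < \<sigma> i" and kl: "1 \<le> k" "k < l" "l \<le> n" "\<sigma> l < \<sigma> k"
      using that by (auto simp: pq empty_boxes_def)
    have "i \<le> k \<longleftrightarrow> (\<sigma> k, \<sigma> i) \<notin> ?N" if "\<sigma> i \<le> \<sigma> k"
      using that mem[of k i] ij kl inj_eq[OF permutes_inj[OF P], of i k] by fastforce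
    moreover have "l \<le> j \<longleftrightarrow> (\<sigma> j, \<sigma> l) \<notin> ?N" if "\<sigma> l \<le> \<sigma> j"
      using that mem[of j l] ij kl inj_eq[OF permutes_inj[OF P], of l j] by fastforce
    ultimately show ?thesis using ij kl by (auto simp: pq box_le_def value_box_le_def)
  qed
  have f_X: "?f ` X = value_boxes_in n \<I> ?N"
  proof
    show "?f ` X \<subseteq> value_boxes_in n \<I> ?N"
      using box_iff box_arc by (force simp: X_def value_boxes_in_def)
    show "value_boxes_in n \<I> ?N \<subseteq> ?f ` X"
    proof
      fix p assume p: "p \<in> value_boxes_in n \<I> ?N"
      hence "p \<in> ?N" by (auto simp: value_boxes_in_def value_boxes_def)
      then obtain i j where ij: "p = (\<sigma> i, \<sigma> j)" by (auto elim: inversionsE)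
      hence "(i, j) \<in> X" using p box_iff[of i j] box_arc[of "(i, j)"]
        by (auto simp: X_def value_boxes_in_def)
      thus "p \<in> ?f ` X" using ij by force
    qed
  qed
  have f_inj: "?f p = ?f q \<longleftrightarrow> p = q" for p q
    using inj_eq[OF permutes_inj[OF P]] by (cases p; cases q) auto
  have X_boxes: "X \<subseteq> empty_boxes n \<sigma>" by (auto simp: X_def)
  have max_iff: "(\<forall>q \<in> X. box_le \<sigma> p q \<longrightarrow> q = p) \<longleftrightarrow>
      (\<forall>q \<in> value_boxes_in n \<I> ?N. value_box_le ?N (?f p) q \<longrightarrow> q = ?f p)" if "p \<in> X" for p
  proof -
    have "(box_le \<sigma> p q \<longrightarrow> q = p) \<longleftrightarrow> (value_box_le ?N (?f p) (?f q) \<longrightarrow> ?f q = ?f p)" if "q \<in> X" for q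
      using box_le[of p q] f_inj[of q p] that \<open>p \<in> X\<close> X_boxes by blast
    thus ?thesis unfolding f_X[symmetric] by blast
  qed
  have "{lower_arc n \<sigma> (i, j) | i j. (i, j) \<in> maximal_boxes n \<I> \<sigma>} =
      lower_arc n \<sigma> ` maximal_boxes n \<I> \<sigma>" by auto
  also have "\<dots> = lower_arc n \<sigma> ` {p \<in> X. \<forall>q \<in> X. box_le \<sigma> p q \<longrightarrow> q = p}"
    by (simp add: maximal_boxes_def Let_def X_def)
  also have "\<dots> = (\<lambda>p. value_arc n ?N (?f p)) ` {p \<in> X. \<forall>q \<in> X. box_le \<sigma> p q \<longrightarrow> q = p}"
    by (rule image_cong) (use box_arc X_boxes in auto)
  also have "\<dots> = value_arc n ?N ` ?f ` {p \<in> X. \<forall>q \<in> X. box_le \<sigma> p q \<longrightarrow> q = p}"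
    by (simp add: image_image)
  also have "?f ` {p \<in> X. \<forall>q \<in> X. box_le \<sigma> p q \<longrightarrow> q = p} =
      {p \<in> value_boxes_in n \<I> ?N. \<forall>q \<in> value_boxes_in n \<I> ?N. value_box_le ?N p q \<longrightarrow> q = p}"
    (is "?f ` ?A = ?B")
  proof
    show "?f ` ?A \<subseteq> ?B" using max_iff f_X by blast
    show "?B \<subseteq> ?f ` ?A"
    proof
      fix y assume y: "y \<in> ?B"
      then obtain p where "p \<in> X" "y = ?f p" using f_X by blast
      thus "y \<in> ?f ` ?A" using y max_iff by blast
    qed
  qed
  finally show ?thesis unfolding value_diagram_def .
qed

context weak_order_congruence
begin

lemma subarc_closed_congruence_arcs: "subarc_closed n (congruence_arcs n R)"
  unfolding subarc_closed_def mem_congruence_arcs_iff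
  using contracted_superarc by (auto intro: order_trans order_less_le_trans)

text \<open>
  Induction along contracted covers, from \<open>\<tau>\<close> down to the least element \<open>\<pi>\<close> of its class.
\<close>

lemma value_diagram_constant_on_class:
  assumes least: "\<And>\<rho>. (\<pi>, \<rho>) \<in> R \<Longrightarrow> inversions n \<pi> \<subseteq> inversions n \<rho>"
    and R: "(\<pi>, \<tau>) \<in> R"
  shows "value_diagram n (congruence_arcs n R) (inversions n \<tau>) =
    value_diagram n (congruence_arcs n R) (inversions n \<pi>)"
  using R
proof (induction "card (inversions n \<tau>)" arbitrary: \<tau> rule: less_induct)
  case less
  show ?case
  proof (cases "inversions n \<tau> = inversions n \<pi>")
    case False
    hence "inversions n \<pi> \<subset> inversions n \<tau>" using least less.prems by blast
    then obtain d \<rho> where d: "d \<in> descents n \<tau>"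
      and \<rho>: "covers_via n \<rho> \<tau> (\<tau> (d + 1)) (\<tau> d) (arc_interior (inversions n \<tau>) (\<tau> d) (\<tau> (d + 1)))"
      and R: "(\<rho>, \<tau>) \<in> R"
      by (rule exists_contracted_cover[OF less.prems])
    have perms: "\<rho> permutes {1..n}" "\<tau> permutes {1..n}" using R_permutes[OF R] by blast+
    have ins: "inversions n \<tau> = insert (\<tau> d, \<tau> (d + 1)) (inversions n \<rho>)"
      and new: "(\<tau> d, \<tau> (d + 1)) \<notin> inversions n \<rho>"
      using \<rho> by (auto simp: covers_via_def)
    have "value_arc n (inversions n \<tau>) (\<tau> d, \<tau> (d + 1)) \<notin> congruence_arcs n R"
      using \<rho> R contracted_def by (auto simp: value_arc_def mem_congruence_arcs_iff)
    hence "value_diagram n (congruence_arcs n R) (inversions n \<rho>) =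
        value_diagram n (congruence_arcs n R) (inversions n \<tau>)"
      using value_diagram_delete biclosed_inversions perms ins new subarc_closed_congruence_arcs
      by blast
    moreover have "card (inversions n \<rho>) < card (inversions n \<tau>)"
      using new finite_inversions by (simp add: ins)
    moreover have "(\<pi>, \<rho>) \<in> R" using less.prems R R_sym R_trans by blast
    ultimately show ?thesis using less.hyps by metis
  qed simp
qed

lemma descent_arc_in_congruence_arcs:
  assumes P: "\<pi> permutes {1..n}" and fixed: "pi_down n R \<pi> = \<pi>" and d: "d \<in> descents n \<pi>"
  shows "lower_arc n \<pi> (d, d + 1) \<in> congruence_arcs n R"
proof -
  let ?S = "arc_interior (inversions n \<pi>) (\<pi> d) (\<pi> (d + 1))"
  obtain \<rho> where "covers_via n \<rho> \<pi> (\<pi> (d + 1)) (\<pi> d) ?S" using exists_cover_at_descent[OF P d] .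
  moreover have "\<not> contracted (\<pi> (d + 1)) (\<pi> d) ?S" using pi_down_fixed_iff[OF P] fixed d by blast
  moreover have "lower_arc n \<pi> (d, d + 1) = (\<pi> (d + 1), \<pi> d, n, ?S)"
    using lower_arc_eq[OF P, of d "d + 1"] descentD[OF d] by simp
  ultimately show ?thesis using covers_via_valid by (auto simp: mem_congruence_arcs_iff)
qed

lemma pi_down_idem:
  assumes P: "\<sigma> permutes {1..n}"
  shows "pi_down n R (pi_down n R \<sigma>) = pi_down n R \<sigma>"
proof -
  have "(\<sigma>, pi_down n R \<sigma>) \<in> R" by (rule pi_down_related[OF P])
  hence "R `` {pi_down n R \<sigma>} = R `` {\<sigma>}" using equiv_class_eq[OF equiv_R] by metis
  thus ?thesis by (simp add: pi_down_def)
qed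

lemma lower_diagram_pi_down:
  assumes P: "\<sigma> permutes {1..n}"
  shows "lower_diagram n (pi_down n R \<sigma>) =
    {lower_arc n \<sigma> (i, j) | i j. (i, j) \<in> maximal_boxes n (congruence_arcs n R) \<sigma>}"
proof -
  let ?\<pi> = "pi_down n R \<sigma>" and ?I = "congruence_arcs n R"
  note rel = pi_down_related[OF P]
  note Q = R_permutes(2)[OF rel]
  have "lower_diagram n ?\<pi> = {lower_arc n ?\<pi> (i, j) | i j. (i, j) \<in> maximal_boxes n ?I ?\<pi>}"
    using maximal_boxes_eq_descents[OF Q descent_arc_in_congruence_arcs[OF Q pi_down_idem[OF P]]]
    by (auto simp: lower_diagram_def)
  also have "\<dots> = value_diagram n ?I (inversions n ?\<pi>)" by (rule lower_arcs_maximal_boxes_eq[OF Q])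
  also have "\<dots> = value_diagram n ?I (inversions n \<sigma>)"
    using value_diagram_constant_on_class[OF _ R_sym[OF rel]] pi_down_least[OF P] rel R_trans by metis
  also have "\<dots> = {lower_arc n \<sigma> (i, j) | i j. (i, j) \<in> maximal_boxes n ?I \<sigma>}"
    by (rule lower_arcs_maximal_boxes_eq[OF P, symmetric])
  finally show ?thesis .
qed

end

theorem proposition6:
  fixes n :: nat
    and R :: "((nat \<Rightarrow> nat) \<times> (nat \<Rightarrow> nat)) set"
    and \<I> :: "arc set"
    and \<sigma> :: "nat \<Rightarrow> nat"
  assumes "lattice_congruence (weak_order n) R"
    and "\<I> = congruence_arcs n R"
    and "\<sigma> permutes {1..n}"
  shows "eta n R \<sigma> = lower_diagram n (pi_down n R \<sigma>) \<and>
         lower_diagram n (pi_down n R \<sigma>) = {lower_arc n \<sigma> (i, j) | i j. (i, j) \<in> maximal_boxes n \<I> \<sigma>} \<and>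
         noncrossing_arc_diagram n (eta n R \<sigma>) \<and>
         eta n R \<sigma> \<subseteq> \<I> \<and>
         class_diagram n (R `` {\<sigma>}) = eta n R \<sigma>"
proof -
  interpret weak_order_congruence n R by unfold_locales (rule assms(1))
  note Q = R_permutes(2)[OF pi_down_related[OF assms(3)]]
  have "eta n R \<sigma> \<subseteq> \<I>"
    unfolding eta_def lower_diagram_def assms(2)
    using descent_arc_in_congruence_arcs[OF Q pi_down_idem[OF assms(3)]] by blast
  moreover have "noncrossing_arc_diagram n (eta n R \<sigma>)"
    unfolding eta_def by (rule lower_diagram_noncrossing[OF Q])
  moreover have "class_diagram n (R `` {\<sigma>}) = eta n R \<sigma>"
    by (simp add: class_diagram_def eta_def pi_down_def)
  ultimately show ?thesis
    using lower_diagram_pi_down[OF assms(3)] assms(2) by (simp add: eta_def)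
qed

end
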